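(* Let $n \geq 5$, let $\ell \in \mathbb{A}_n$, let $t > 1$ be an integer, and let $\theta \in \{\mathrm{id}, \iota_{(1\ 2)}\}$ be an automorphism of $\mathbb{A}_n$. If the twisted homogeneous rack $\mathcal{C}_\ell$ of type $(\mathbb{A}_n, t, \theta)$ is not of type D, then at least one of the following holds: (1) $\theta = \mathrm{id}$ and $\ell = e$, with $\gcd(t, n!) = 1$. (2) $\theta = \mathrm{id}$ and $\ell = e$, with $n = 5$ and $t = 2$. (3) $\theta = \mathrm{id}$ and $\ell = e$, with $n = 6$ and $t = 2$. (4) $\theta = \iota_{(1\ 2)}$ and $\ell\,(1\ 2)$ is of cycle type $(1^{s_1}, 2^{s_2}, \dots, n^{s_n})$ with $s_1 \leq 1$ and $s_2 = 0$. (5) $\theta = \iota_{(1\ 2)}$ and $\ell\,(1\ 2)$ is of cycle type $(1^{s_1}, 2^{s_2}, 4^{s_4})$ with $s_1 \leq 2$ or $s_2 \geq 1$, and $t = 2$.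
   Context: $\mathbb{S}_n$ and $\mathbb{A}_n$ are the symmetric and alternating groups on $\{1,\dots,n\}$, and $e$ is the identity element. For $u \in \mathbb{S}_n$, $\iota_u$ denotes the automorphism of $\mathbb{A}_n$ given by conjugation by $u$, $g \mapsto u g u^{-1}$. Cycle type $(1^{s_1}, 2^{s_2}, \dots, n^{s_n})$ means exactly $s_i$ cycles of length $i$ for each $i$ (fixed points are counted as $1$-cycles, so $\sum_i i s_i = n$); lengths not listed occur zero times, and the $s_i$ are non-negative integers. A rack is a non-empty set $X$ with a map $\triangleright : X \times X \to X$ such that every $\varphi_x : y \mapsto x \triangleright y$ is a bijection and $x \triangleright (y \triangleright z) = (x \triangleright y) \triangleright (x \triangleright z)$ for all $x, y, z \in X$. A subrack of $X$ is a non-empty subset $Y$ with $Y \triangleright Y = Y$. A decomposition of a rack $Y$ as $Y = R \coprod S$ means that $R, S$ are disjoint subracks of $Y$ with union $Y$, $Y \triangleright R = R$ and $Y \triangleright S = S$. A rack $X$ is of type D if there exist a subrack $Y$ of $X$ with a decomposition $Y = R \coprod S$ and elements $r \in R$, $s \in S$ such that $r \triangleright (s \triangleright (r \triangleright s)) \neq s$. Twisted homogeneous racks: for a group $L$, an integer $t \geq 1$ and $\theta \in \mathrm{Aut}(L)$, let $f : L^t \to L^t$ be the automorphism $f(\ell_1, \dots, \ell_t) = (\theta(\ell_t), \ell_1, \dots, \ell_{t-1})$. For $\ell \in L$, the twisted homogeneous rack $\mathcal{C}_\ell$ of type $(L, t, \theta)$ is the orbit of $(e, \dots, e, \ell) \in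 L^t$ under the action of $L^t$ on itself given by $y \rightharpoonup x = y\, x\, f(y^{-1})$, with rack operation $y \triangleright z = y\, f(z y^{-1})$. *)

theory Defs
  imports
    "HOL-Algebra.Sym_Groups"
    "HOL-Algebra.Product_Groups"
    "HOL-Algebra.Bij"
    "HOL-Combinatorics.Orbits"
begin

section \<open>Racks\<close>

definition rack :: "('a \<Rightarrow> 'a \<Rightarrow> 'a) \<Rightarrow> 'a set \<Rightarrow> bool" where
  "rack op X \<longleftrightarrow> X \<noteq> {} \<and> (\<forall>x\<in>X. bij_betw (op x) X X) \<and>
     (\<forall>x\<in>X. \<forall>y\<in>X. \<forall>z\<in>X. op x (op y z) = op (op x y) (op x z))"

definition rack_set_op :: "('a \<Rightarrow> 'a \<Rightarrow> 'a) \<Rightarrow> 'a set \<Rightarrow> 'a set \<Rightarrow> 'a set" where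
  "rack_set_op op A B = {op a b | a b. a \<in> A \<and> b \<in> B}"

definition subrack :: "('a \<Rightarrow> 'a \<Rightarrow> 'a) \<Rightarrow> 'a set \<Rightarrow> 'a set \<Rightarrow> bool" where
  "subrack op X Y \<longleftrightarrow> Y \<noteq> {} \<and> Y \<subseteq> X \<and> rack_set_op op Y Y = Y"

definition rack_decomposition ::
  "('a \<Rightarrow> 'a \<Rightarrow> 'a) \<Rightarrow> 'a set \<Rightarrow> 'a set \<Rightarrow> 'a set \<Rightarrow> bool" where
  "rack_decomposition op Y R S \<longleftrightarrow>
     subrack op Y R \<and> subrack op Y S \<and> R \<inter> S = {} \<and> R \<union> S = Y \<and>
     rack_set_op op Y R = R \<and> rack_set_op op Y S = S"

text \<open>The following notions are meant for sets \<open>X\<close> with \<open>rack op X\<close>; for twisted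
  homogeneous racks this is lemma \<open>rack_twisted_rack\<close> below.\<close>

definition type_D :: "('a \<Rightarrow> 'a \<Rightarrow> 'a) \<Rightarrow> 'a set \<Rightarrow> bool" where
  "type_D op X \<longleftrightarrow>
     (\<exists>Y R S. subrack op X Y \<and> rack_decomposition op Y R S \<and>
        (\<exists>r\<in>R. \<exists>s\<in>S. op r (op s (op r s)) \<noteq> s))"


section \<open>Twisted homogeneous racks\<close>

text \<open>Elements of \<open>L\<^sup>t\<close> are extensional functions on \<open>{1..t}\<close>.\<close>

definition power_group :: "('a, 'b) monoid_scheme \<Rightarrow> nat \<Rightarrow> (nat \<Rightarrow> 'a) monoid" where
  "power_group L t = product_group {1..t} (\<lambda>_. L)"

definition cyclic_twist :: "nat \<Rightarrow> ('a \<Rightarrow> 'a) \<Rightarrow> (nat \<Rightarrow> 'a) \<Rightarrow> (nat \<Rightarrow> 'a)" where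
  "cyclic_twist t \<theta> x = (\<lambda>i\<in>{1..t}. if i = 1 then \<theta> (x t) else x (i - 1))"

definition twisted_op ::
  "('a, 'b) monoid_scheme \<Rightarrow> nat \<Rightarrow> ('a \<Rightarrow> 'a) \<Rightarrow> (nat \<Rightarrow> 'a) \<Rightarrow> (nat \<Rightarrow> 'a) \<Rightarrow> (nat \<Rightarrow> 'a)" where
  "twisted_op L t \<theta> y z =
     y \<otimes>\<^bsub>power_group L t\<^esub>
       cyclic_twist t \<theta> (z \<otimes>\<^bsub>power_group L t\<^esub> inv\<^bsub>power_group L t\<^esub> y)"

definition twisted_action ::
  "('a, 'b) monoid_scheme \<Rightarrow> nat \<Rightarrow> ('a \<Rightarrow> 'a) \<Rightarrow> (nat \<Rightarrow> 'a) \<Rightarrow> (nat \<Rightarrow> 'a) \<Rightarrow> (nat \<Rightarrow> 'a)" where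
  "twisted_action L t \<theta> y x =
     y \<otimes>\<^bsub>power_group L t\<^esub> x \<otimes>\<^bsub>power_group L t\<^esub>
       cyclic_twist t \<theta> (inv\<^bsub>power_group L t\<^esub> y)"

definition last_embed :: "('a, 'b) monoid_scheme \<Rightarrow> nat \<Rightarrow> 'a \<Rightarrow> (nat \<Rightarrow> 'a)" where
  "last_embed L t l = (\<lambda>i\<in>{1..t}. if i = t then l else \<one>\<^bsub>L\<^esub>)"

definition twisted_rack ::
  "('a, 'b) monoid_scheme \<Rightarrow> nat \<Rightarrow> ('a \<Rightarrow> 'a) \<Rightarrow> 'a \<Rightarrow> (nat \<Rightarrow> 'a) set" where
  "twisted_rack L t \<theta> l =
     (\<lambda>y. twisted_action L t \<theta> y (last_embed L t l)) ` carrier (power_group L t)"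

lemma rack_twisted_rack:
  fixes L (structure)
  assumes L: "group L" and t: "t \<ge> 1" and th_auto: "\<theta> \<in> auto L" and l: "l \<in> carrier L"
  shows "rack (twisted_op L t \<theta>) (twisted_rack L t \<theta> l)"
proof -
  define P where "P = power_group L t"
  define f where "f = cyclic_twist t \<theta>"
  define b where "b = last_embed L t l"
  define C where "C = twisted_rack L t \<theta> l"
  define op where "op = twisted_op L t \<theta>"
  interpret P: group P
    unfolding P_def power_group_def using L by simp
  have th: "\<theta> x \<in> carrier L" if "x \<in> carrier L" for x
    using th_auto that by (auto simp: auto_def hom_def)
  have th_mult: "\<theta> (x \<otimes> y) = \<theta> x \<otimes> \<theta> y" if "x \<in> carrier L" "y \<in> carrier L" for x y
    using th_auto that by (auto simp: auto_def hom_def)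
  have th_bij: "bij_betw \<theta> (carrier L) (carrier L)"
    using th_auto by (auto simp: auto_def Bij_def)
  have cP: "carrier P = (\<Pi>\<^sub>E i\<in>{1..t}. carrier L)"
    by (simp add: P_def power_group_def)
  have mP: "x \<otimes>\<^bsub>P\<^esub> y = (\<lambda>i\<in>{1..t}. x i \<otimes> y i)" for x y
    by (simp add: P_def power_group_def)
  have comp: "x i \<in> carrier L" if "x \<in> carrier P" "Suc 0 \<le> i" "i \<le> t" for x i
    using that by (auto simp: cP PiE_iff)
  have fc: "f x \<in> carrier P" if "x \<in> carrier P" for x
    unfolding cP f_def cyclic_twist_def
    using t comp[OF that] by (auto intro!: th)
  have fm: "f (x \<otimes>\<^bsub>P\<^esub> y) = f x \<otimes>\<^bsub>P\<^esub> f y" if "x \<in> carrier P" "y \<in> carrier P" for x y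
    unfolding mP f_def cyclic_twist_def
    using t comp[OF that(1)] comp[OF that(2)] by (auto simp: fun_eq_iff intro!: th_mult)
  have fhom: "f \<in> hom P P"
    using fc fm by (auto simp: hom_def)
  then interpret f: group_hom P P f
    by unfold_locales
  have finj: "inj_on f (carrier P)"
  proof (rule inj_onI)
    fix x y assume x: "x \<in> carrier P" and y: "y \<in> carrier P" and e: "f x = f y"
    show "x = y"
    proof (rule PiE_ext[OF x[unfolded cP] y[unfolded cP]])
      fix i assume i: "i \<in> {1..t}"
      show "x i = y i"
      proof (cases "i = t")
        case True
        have "\<theta> (x t) = \<theta> (y t)"
          using fun_cong[OF e, of 1] t by (simp add: f_def cyclic_twist_def)
        then show ?thesis
          using True x y i th_bij unfolding cP bij_betw_def inj_on_def by (auto simp: PiE_iff)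
      next
        case False
        then show ?thesis
          using fun_cong[OF e, of "Suc i"] i by (simp add: f_def cyclic_twist_def)
      qed
    qed
  qed
  have bc: "b \<in> carrier P"
    using l L unfolding b_def last_embed_def cP by (auto simp: group.is_monoid)
  have op_eq: "op y z = y \<otimes>\<^bsub>P\<^esub> f (z \<otimes>\<^bsub>P\<^esub> inv\<^bsub>P\<^esub> y)" for y z
    by (simp add: op_def twisted_op_def P_def f_def)
  have cancel: "inv\<^bsub>P\<^esub> u \<otimes>\<^bsub>P\<^esub> (u \<otimes>\<^bsub>P\<^esub> w) = w" "u \<otimes>\<^bsub>P\<^esub> (inv\<^bsub>P\<^esub> u \<otimes>\<^bsub>P\<^esub> w) = w"
    if "u \<in> carrier P" "w \<in> carrier P" for u w
    using that by (simp_all flip: P.m_assoc)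
  have C_eq: "C = (\<lambda>y. y \<otimes>\<^bsub>P\<^esub> b \<otimes>\<^bsub>P\<^esub> f (inv\<^bsub>P\<^esub> y)) ` carrier P"
    by (simp add: C_def twisted_rack_def twisted_action_def b_def P_def f_def)
  have CP: "C \<subseteq> carrier P"
    unfolding C_eq using bc fc by auto
  have bij: "bij_betw (op x) C C" if x: "x \<in> C" for x
  proof -
    from x CP have xP: "x \<in> carrier P" by blast
    have inj: "inj_on (op x) C"
    proof (rule inj_onI)
      fix y z assume "y \<in> C" "z \<in> C" and e: "op x y = op x z"
      then have y: "y \<in> carrier P" and z: "z \<in> carrier P" using CP by auto
      have "f (y \<otimes>\<^bsub>P\<^esub> inv\<^bsub>P\<^esub> x) = f (z \<otimes>\<^bsub>P\<^esub> inv\<^bsub>P\<^esub> x)"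
        using e xP y z fc by (simp add: op_eq del: f.hom_mult)
      then have "y \<otimes>\<^bsub>P\<^esub> inv\<^bsub>P\<^esub> x = z \<otimes>\<^bsub>P\<^esub> inv\<^bsub>P\<^esub> x"
        using finj xP y z by (meson P.inv_closed P.m_closed inj_onD)
      then show "y = z" using xP y z by simp
    qed
    have fsurj: "\<exists>v\<in>carrier P. f v = u" if u: "u \<in> carrier P" for u
    proof
      let ?v = "\<lambda>i\<in>{1..t}. if i = t then inv_into (carrier L) \<theta> (u 1) else u (Suc i)"
      have u1: "u 1 \<in> \<theta> ` carrier L"
        using u t th_bij unfolding cP by (auto simp: PiE_iff bij_betw_def)
      show "?v \<in> carrier P"
        using u u1 unfolding cP by (auto simp: PiE_iff inv_into_into)
      show "f ?v = u"
        using u u1 t unfolding cP f_def cyclic_twist_def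
        by (auto simp: fun_eq_iff PiE_iff extensional_def f_inv_into_f)
    qed
    have img: "op x (v \<otimes>\<^bsub>P\<^esub> b \<otimes>\<^bsub>P\<^esub> f (inv\<^bsub>P\<^esub> v)) =
        (x \<otimes>\<^bsub>P\<^esub> f v \<otimes>\<^bsub>P\<^esub> inv\<^bsub>P\<^esub> b) \<otimes>\<^bsub>P\<^esub> b \<otimes>\<^bsub>P\<^esub>
          f (inv\<^bsub>P\<^esub> (x \<otimes>\<^bsub>P\<^esub> f v \<otimes>\<^bsub>P\<^esub> inv\<^bsub>P\<^esub> b))"
      if v: "v \<in> carrier P" for v
      using v xP bc fc by (simp add: op_eq P.m_assoc P.inv_mult_group cancel)
    have "op x ` C = C"
    proof
      show "op x ` C \<subseteq> C"
      proof
        fix c assume "c \<in> op x ` C"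
        then obtain v where v: "v \<in> carrier P"
          and "c = op x (v \<otimes>\<^bsub>P\<^esub> b \<otimes>\<^bsub>P\<^esub> f (inv\<^bsub>P\<^esub> v))"
          unfolding C_eq by blast
        moreover have "x \<otimes>\<^bsub>P\<^esub> f v \<otimes>\<^bsub>P\<^esub> inv\<^bsub>P\<^esub> b \<in> carrier P"
          using v xP bc fc by simp
        ultimately show "c \<in> C"
          unfolding C_eq using img[OF v] by blast
      qed
      show "C \<subseteq> op x ` C"
      proof
        fix c assume "c \<in> C"
        then obtain u where u: "u \<in> carrier P"
          and c: "c = u \<otimes>\<^bsub>P\<^esub> b \<otimes>\<^bsub>P\<^esub> f (inv\<^bsub>P\<^esub> u)"
          unfolding C_eq by blast
        obtain v where v: "v \<in> carrier P" and fv: "f v = inv\<^bsub>P\<^esub> x \<otimes>\<^bsub>P\<^esub> u \<otimes>\<^bsub>P\<^esub> b"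
          using fsurj[of "inv\<^bsub>P\<^esub> x \<otimes>\<^bsub>P\<^esub> u \<otimes>\<^bsub>P\<^esub> b"] xP u bc by blast
        have "x \<otimes>\<^bsub>P\<^esub> f v \<otimes>\<^bsub>P\<^esub> inv\<^bsub>P\<^esub> b = u"
          using xP u bc by (simp add: fv P.m_assoc cancel)
        with img[OF v] have "c = op x (v \<otimes>\<^bsub>P\<^esub> b \<otimes>\<^bsub>P\<^esub> f (inv\<^bsub>P\<^esub> v))"
          by (simp add: c)
        with v show "c \<in> op x ` C" unfolding C_eq by blast
      qed
    qed
    with inj show ?thesis by (simp add: bij_betw_def)
  qed
  have dist: "op x (op y z) = op (op x y) (op x z)" if "x \<in> C" "y \<in> C" "z \<in> C" for x y z
  proof -
    from that CP have "x \<in> carrier P" "y \<in> carrier P" "z \<in> carrier P" by auto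
    then show ?thesis
      by (simp add: op_eq P.m_assoc P.inv_mult_group cancel)
  qed
  have "C \<noteq> {}" unfolding C_eq by blast
  with bij dist show ?thesis
    unfolding rack_def C_def[symmetric] op_def[symmetric] by blast
qed


section \<open>Automorphisms of alternating groups and cycle types\<close>

text \<open>\<^const>\<open>auto\<close> consists of extensional functions, so automorphisms of
  \<open>alt_group n\<close> are taken to be \<open>undefined\<close> outside the carrier.\<close>

definition alt_conj :: "nat \<Rightarrow> (nat \<Rightarrow> nat) \<Rightarrow> (nat \<Rightarrow> nat) \<Rightarrow> (nat \<Rightarrow> nat)" where
  "alt_conj n u = (\<lambda>g\<in>carrier (alt_group n). u \<circ> g \<circ> inv' u)"

lemma alt_conj_in_auto:
  assumes u: "u permutes {1..n}"
  shows "alt_conj n u \<in> auto (alt_group n)"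
proof -
  let ?A = "carrier (alt_group n)"
  have closed: "v \<circ> g \<circ> inv' v \<in> ?A" if v: "v permutes {1..n}" and g: "g \<in> ?A" for v g
  proof -
    have vi: "inv' v permutes {1..n}" using v by (rule permutes_inv)
    have gp: "g permutes {1..n}" and ge: "evenperm g"
      using g by (auto simp: alt_group_carrier)
    have perms: "permutation v" "permutation g" "permutation (inv' v)"
      using v gp vi by (auto simp: permutation_permutes)
    have "evenperm (v \<circ> g \<circ> inv' v)"
      using perms ge by (simp add: evenperm_comp permutation_compose evenperm_inv)
    moreover have "v \<circ> g \<circ> inv' v permutes {1..n}"
      using v gp vi by (intro permutes_compose)
    ultimately show ?thesis by (simp add: alt_group_carrier)
  qed
  have iu: "inv' u permutes {1..n}" using u by (rule permutes_inv)
  have iiu: "inv' (inv' u) = u" using u by (simp add: inv_inv_eq permutes_bij)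
  have uu: "u (inv' u x) = x" "inv' u (u x) = x" for x
    using permutes_inverses[OF u] by auto
  have "bij_betw (alt_conj n u) ?A ?A"
  proof (rule bij_betw_byWitness[where f' = "alt_conj n (inv' u)"])
    show "alt_conj n u ` ?A \<subseteq> ?A" "alt_conj n (inv' u) ` ?A \<subseteq> ?A"
      using closed[OF u] closed[OF iu] by (auto simp: alt_conj_def)
    show "\<forall>a\<in>?A. alt_conj n (inv' u) (alt_conj n u a) = a"
      using closed[OF u] by (auto simp: alt_conj_def iiu uu fun_eq_iff)
    show "\<forall>a\<in>?A. alt_conj n u (alt_conj n (inv' u) a) = a"
      using closed[OF iu] by (auto simp: alt_conj_def iiu uu fun_eq_iff)
  qed
  moreover have "alt_conj n u \<in> hom (alt_group n) (alt_group n)"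
  proof (rule homI)
    show "alt_conj n u x \<in> ?A" if "x \<in> ?A" for x
      using that closed[OF u] by (simp add: alt_conj_def)
    show "alt_conj n u (x \<otimes>\<^bsub>alt_group n\<^esub> y) =
        alt_conj n u x \<otimes>\<^bsub>alt_group n\<^esub> alt_conj n u y" if "x \<in> ?A" "y \<in> ?A" for x y
    proof -
      have "x \<circ> y \<in> ?A"
        using that group.is_monoid[OF alt_group_is_group, of n] monoid.m_closed
        by (fastforce simp: alt_group_mult)
      then show ?thesis
        using that by (auto simp: alt_conj_def alt_group_mult uu fun_eq_iff)
    qed
  qed
  ultimately show ?thesis
    by (simp add: auto_def Bij_def) (simp add: alt_conj_def)
qed

text \<open>If \<open>p\<close> has cycle type \<open>(1\<^sup>s\<^sub>1, 2\<^sup>s\<^sub>2, \<dots>, n\<^sup>s\<^sub>n)\<close> as a permutation of \<open>{1..n}\<close>,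
  then \<open>cycle_type n p i\<close> is \<open>s\<^sub>i\<close>; fixed points are orbits of size 1.\<close>

definition cycle_type :: "nat \<Rightarrow> (nat \<Rightarrow> nat) \<Rightarrow> nat \<Rightarrow> nat" where
  "cycle_type n p i = card {C \<in> orbit p ` {1..n}. card C = i}"

end

theory Submission
  imports Defs "HOL-Number_Theory.Cong"
begin

text \<open>Multiplying the first entry of a \<open>t\<close>-tuple by \<open>\<tau> \<in> {id, (1 2)}\<close> turns the rack into the set of
  tuples \<open>X\<close> of permutations (the first entry having the parity of \<open>\<tau>\<close>, the others even) whose
  product \<open>X\<^sub>t \<cdots> X\<^sub>1\<close> is conjugate under the alternating group to \<open>\<sigma> = l \<tau>\<close>, with operation
  \<open>(Y \<triangleright> Z)\<^sub>i = Y\<^sub>i Z\<^sub>i\<^sub>-\<^sub>1 Y\<^sub>i\<^sub>-\<^sub>1\<inverse>\<close>, indices being cyclic. To prove type D one needs an invariant of this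
  operation, on tuples from a subgroup, which separates \<open>r\<close> from \<open>s\<close>. Two invariants suffice.

  If the entries lie in an abelian subgroup, the product is invariant; so a conjugate \<open>\<sigma>' \<noteq> \<sigma>\<close> commuting
  with \<open>\<sigma>\<close> (and with \<open>\<sigma>'\<^sup>2 \<noteq> \<sigma>\<^sup>2\<close> when \<open>t = 2\<close>) gives type D by comparing \<open>(\<sigma>, e, \<dots>, e)\<close> and
  \<open>(\<sigma>', e, \<dots>, e)\<close>. Such a \<open>\<sigma>'\<close> is obtained by replacing \<open>\<sigma>\<close> with a power on one or two cycles,
  or, for an involution, by rearranging two of its transpositions.

  If \<open>m\<close> divides \<open>t\<close> and \<open>\<chi>\<close> is a character to \<open>\<int>/m\<close>, then \<open>\<Sum>i. i \<chi>(X\<^sub>i)\<close> is invariant for a fixed value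
  of \<open>\<Sum>i. \<chi>(X\<^sub>i)\<close>. With the sign on an invariant set of points (\<open>m = 2\<close>) or the rotations of \<open>p\<close> points
  (\<open>m = p\<close>) as \<open>\<chi>\<close>, this settles \<open>l = e\<close> and the permutations with an even cycle for \<open>t = 2\<close>.\<close>


section \<open>Racks of tuples over a normal subgroup\<close>

text \<open>Since every element satisfies \<open>op a a = a\<close>, a set always lies in its
  product with any larger set. The equalities between sets in the definition of a decomposition thus
  reduce to closure of \<open>R\<close> and \<open>S\<close> under the action of their
  union.\<close>

lemma type_DI:
  assumes sub: "R \<subseteq> X" "S \<subseteq> X" and disj: "R \<inter> S = {}"
    and R: "\<And>a b. a \<in> R \<union> S \<Longrightarrow> b \<in> R \<Longrightarrow> op a b \<in> R"
    and S: "\<And>a b. a \<in> R \<union> S \<Longrightarrow> b \<in> S \<Longrightarrow> op a b \<in> S"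
    and idem: "\<And>a. a \<in> X \<Longrightarrow> op a a = a"
    and rs: "r \<in> R" "s \<in> S" "op r (op s (op r s)) \<noteq> s"
  shows "type_D op X"
proof -
  have onto: "rack_set_op op B T = T"
    if "T \<subseteq> B" "B \<subseteq> R \<union> S" "\<And>a b. a \<in> B \<Longrightarrow> b \<in> T \<Longrightarrow> op a b \<in> T" for B T
  proof -
    have "t \<in> rack_set_op op B T" if "t \<in> T" for t
    proof -
      have "op t t = t" using that \<open>T \<subseteq> B\<close> \<open>B \<subseteq> R \<union> S\<close> sub by (intro idem) auto
      then show ?thesis using that \<open>T \<subseteq> B\<close> unfolding rack_set_op_def
        by (intro CollectI exI[of _ t]) auto
    qed
    then show ?thesis using that(3) by (auto simp: rack_set_op_def)
  qed
  have "rack_set_op op (R \<union> S) (R \<union> S) = R \<union> S" using R S by (intro onto) blast+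
  moreover have "rack_set_op op (R \<union> S) R = R" using R by (intro onto) blast+
  moreover have "rack_set_op op (R \<union> S) S = S" using S by (intro onto) blast+
  moreover have "rack_set_op op R R = R" using R by (intro onto) blast+
  moreover have "rack_set_op op S S = S" using S by (intro onto) blast+
  ultimately have "subrack op X (R \<union> S)" "rack_decomposition op (R \<union> S) R S"
    using sub disj rs by (auto simp: subrack_def rack_decomposition_def)
  then show ?thesis using rs unfolding type_D_def by blast
qed

text \<open>The case of interest is the alternating group \<open>K\<close> in the symmetric group,
  with \<open>\<tau>\<close> the identity or \<open>(1 2)\<close>. Keeping \<open>\<theta>\<close>
  as a parameter that agrees with conjugation by \<open>\<tau>\<close> on \<open>K\<close>
  accommodates the extensional functions in \<open>auto\<close>, which are undefined off
  \<open>K\<close>.\<close>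

locale conj_twist = group G for G (structure) +
  fixes K :: "'a set" and \<tau> :: 'a and \<theta> :: "'a \<Rightarrow> 'a" and t :: nat
  assumes normal: "K \<lhd> G" and tau: "\<tau> \<in> carrier G"
    and theta_auto: "\<theta> \<in> auto (G\<lparr>carrier := K\<rparr>)"
    and theta: "\<And>g. g \<in> K \<Longrightarrow> \<theta> g = \<tau> \<otimes> g \<otimes> inv \<tau>"
    and t: "2 \<le> t"
begin

abbreviation "L \<equiv> G\<lparr>carrier := K\<rparr>"

text \<open>Multiplying the first entry by \<open>\<tau>\<close> removes the twist from the rack operation.\<close>

definition untwist :: "(nat \<Rightarrow> 'a) \<Rightarrow> nat \<Rightarrow> 'a" where
  "untwist x i = (if i = 1 then x 1 \<otimes> \<tau> else x i)"

text \<open>Undoes \<open>untwist\<close>. The restriction is there because elements of the power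
  group are extensional, whereas untwisted tuples are compared only entrywise on
  \<open>{1..t}\<close>.\<close>

definition retwist :: "(nat \<Rightarrow> 'a) \<Rightarrow> nat \<Rightarrow> 'a" where
  "retwist X = (\<lambda>i\<in>{1..t}. if i = 1 then X 1 \<otimes> inv \<tau> else X i)"

definition prev :: "nat \<Rightarrow> nat" where
  "prev i = (if i = 1 then t else i - 1)"

text \<open>The factors stand in descending order, from \<open>X k\<close> down to
  \<open>X 1\<close>. In this order the entries
  \<open>y i \<otimes> x i \<otimes> inv y (i - 1)\<close> produced by the twisted action
  telescope.\<close>

primrec rprod :: "(nat \<Rightarrow> 'a) \<Rightarrow> nat \<Rightarrow> 'a" where
  "rprod X 0 = \<one>"
| "rprod X (Suc k) = X (Suc k) \<otimes> rprod X k"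

lemma subgroup_K: "subgroup K G"
  using normal by (rule normal_imp_subgroup)

lemma group_L: "group L"
  using subgroup_K by (rule subgroup_imp_group)

lemma K_carrier: "g \<in> K \<Longrightarrow> g \<in> carrier G"
  using subgroup_K by (rule subgroup.mem_carrier)

lemma theta_closed: "g \<in> K \<Longrightarrow> \<theta> g \<in> K"
  using theta_auto by (auto simp: auto_def hom_def)

lemma inv_L: "g \<in> K \<Longrightarrow> inv\<^bsub>L\<^esub> g = inv g"
  using subgroup_K by (simp add: m_inv_consistent)

lemma cancel [simp]:
  assumes "u \<in> carrier G" "w \<in> carrier G"
  shows "inv u \<otimes> (u \<otimes> w) = w" "u \<otimes> (inv u \<otimes> w) = w"
  using assms by (simp_all flip: m_assoc)

lemma prev_range: "i \<in> {1..t} \<Longrightarrow> prev i \<in> {1..t}"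
  using t by (auto simp: prev_def)

lemma carrier_power: "carrier (power_group L t) = (\<Pi>\<^sub>E i\<in>{1..t}. K)"
  by (simp add: power_group_def)

lemma mult_power: "x \<otimes>\<^bsub>power_group L t\<^esub> y = (\<lambda>i\<in>{1..t}. x i \<otimes> y i)"
  by (simp add: power_group_def)

lemma inv_power:
  assumes "x \<in> (\<Pi>\<^sub>E i\<in>{1..t}. K)"
  shows "inv\<^bsub>power_group L t\<^esub> x = (\<lambda>i\<in>{1..t}. inv (x i))"
proof -
  have "inv\<^bsub>power_group L t\<^esub> x = (\<lambda>i\<in>{1..t}. inv\<^bsub>L\<^esub> (x i))"
    unfolding power_group_def using assms group_L by (subst inv_product_group) auto
  then show ?thesis using assms by (auto simp: inv_L PiE_iff)
qed

lemma untwist_carrier: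
  "x \<in> (\<Pi>\<^sub>E i\<in>{1..t}. K) \<Longrightarrow> i \<in> {1..t} \<Longrightarrow> untwist x i \<in> carrier G"
  using tau t by (auto simp: untwist_def PiE_iff K_carrier)

lemma untwist_twisted_op:
  assumes y: "y \<in> (\<Pi>\<^sub>E i\<in>{1..t}. K)" and z: "z \<in> (\<Pi>\<^sub>E i\<in>{1..t}. K)" and i: "i \<in> {1..t}"
  shows "untwist (twisted_op L t \<theta> y z) i =
    untwist y i \<otimes> untwist z (prev i) \<otimes> inv (untwist y (prev i))"
proof -
  have c: "y j \<in> K" "z j \<in> K" "y j \<in> carrier G" "z j \<in> carrier G" if "j \<in> {1..t}" for j
    using y z that by (auto simp: PiE_iff K_carrier)
  have th: "\<theta> (z t \<otimes> inv y t) = \<tau> \<otimes> (z t \<otimes> inv y t) \<otimes> inv \<tau>"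
    using c[of t] t subgroup_K by (intro theta) (auto intro: subgroup.m_closed subgroup.m_inv_closed)
  have op: "twisted_op L t \<theta> y z i =
      y i \<otimes> (if i = 1 then \<theta> (z t \<otimes> inv y t) else z (i - 1) \<otimes> inv y (i - 1))"
    if "i \<in> {1..t}" for i
    using that t by (auto simp: twisted_op_def cyclic_twist_def mult_power inv_power[OF y])
  show ?thesis
  proof (cases "i = 1")
    case True
    then show ?thesis
      using c[of 1] c[of t] t tau op[OF i] by (simp add: untwist_def prev_def th m_assoc)
  next
    case False
    then have i2: "i - 1 \<in> {1..t}" using i by auto
    \<comment> \<open>At \<open>i = 2\<close> the predecessor is the modified first entry, and the
      two factors \<open>\<tau>\<close> cancel in
      \<open>untwist z 1 \<otimes> inv (untwist y 1)\<close>.\<close>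
    show ?thesis
    proof (cases "i = 2")
      case True
      then show ?thesis
        using c[OF i] c[of 1] t tau op[OF i]
        by (simp add: untwist_def prev_def m_assoc inv_mult_group)
    next
      case False
      then show ?thesis
        using \<open>i \<noteq> 1\<close> c[OF i] c[OF i2] t tau op[OF i] i
        by (auto simp: untwist_def prev_def m_assoc)
    qed
  qed
qed

lemma untwist_retwist:
  "X 1 \<in> carrier G \<Longrightarrow> i \<in> {1..t} \<Longrightarrow> untwist (retwist X) i = X i"
  using tau by (auto simp: untwist_def retwist_def m_assoc)

lemma untwist_eq_iff:
  assumes "x \<in> (\<Pi>\<^sub>E i\<in>{1..t}. K)" "y \<in> (\<Pi>\<^sub>E i\<in>{1..t}. K)"
    "\<And>i. i \<in> {1..t} \<Longrightarrow> untwist x i = untwist y i"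
  shows "x = y"
proof (rule PiE_ext[OF assms(1,2)])
  fix i assume i: "i \<in> {1..t}"
  then have "x i \<in> carrier G" "y i \<in> carrier G" using assms by (auto simp: PiE_iff K_carrier)
  then show "x i = y i"
    using assms(3)[OF i] tau by (auto simp: untwist_def split: if_splits)
qed

section \<open>Products of tuples and membership in the rack\<close>

lemma rprod_closed:
  "(\<And>i. i \<in> {1..k} \<Longrightarrow> X i \<in> carrier G) \<Longrightarrow> rprod X k \<in> carrier G"
  by (induction k) auto

lemma rprod_subgroup:
  "subgroup H G \<Longrightarrow> (\<And>i. i \<in> {1..k} \<Longrightarrow> X i \<in> H) \<Longrightarrow> rprod X k \<in> H"
  by (induction k) (auto intro: subgroup.m_closed subgroup.one_closed)

lemma rprod_cong:
  "(\<And>i. i \<in> {1..k} \<Longrightarrow> X i = Y i) \<Longrightarrow> rprod X k = rprod Y k"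
  by (induction k) auto

text \<open>In the product of \<open>W\<close> each \<open>inv Y i\<close> with \<open>i < t\<close>
  meets \<open>Y i\<close> and cancels. This leaves the factors of \<open>Z\<close>, in cyclically
  shifted order, between \<open>Y t\<close> and \<open>inv Y t\<close>; a cyclic shift of the order
  is a conjugation.\<close>

lemma rprod_op:
  assumes Y: "\<And>i. i \<in> {1..t} \<Longrightarrow> Y i \<in> carrier G" and Z: "\<And>i. i \<in> {1..t} \<Longrightarrow> Z i \<in> carrier G"
    and W: "\<And>i. i \<in> {1..t} \<Longrightarrow> W i = Y i \<otimes> Z (prev i) \<otimes> inv Y (prev i)"
  shows "rprod W t = (Y t \<otimes> inv Z t) \<otimes> rprod Z t \<otimes> inv (Y t \<otimes> inv Z t)"
proof -
  have tt: "t \<in> {1..t}" using t by simp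
  \<comment> \<open>The first \<open>k\<close> factors of \<open>W\<close> involve \<open>Z\<close>
    at \<open>k - 1\<close> down to \<open>1\<close> and then at \<open>t\<close>; the factor
    \<open>inv Z k\<close> compensates for the \<open>Z k\<close> contained in
    \<open>rprod Z k\<close>.\<close>
  have "k \<ge> 1 \<Longrightarrow> k \<le> t \<Longrightarrow>
      rprod W k = Y k \<otimes> inv Z k \<otimes> rprod Z k \<otimes> (Z t \<otimes> inv Y t)" for k
  proof (induction k rule: dec_induct)
    case base
    then show ?case using Y[of 1] Z[of 1] Y[OF tt] Z[OF tt] W[of 1]
      by (simp add: prev_def m_assoc)
  next
    case (step k)
    have "rprod Z k \<in> carrier G" using Z step by (intro rprod_closed) auto
    then show ?case using Y[of k] Z[of k] Y[of "Suc k"] Z[of "Suc k"] Y[OF tt] Z[OF tt]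
        W[of "Suc k"] step by (simp add: prev_def m_assoc)
  qed
  from this[of t] show ?thesis
    using t Y[OF tt] Z[OF tt] by (simp add: inv_mult_group)
qed

text \<open>The orbit of \<open>(e, ..., e, l)\<close> in untwisted coordinates: the first entry
  lies in the coset of \<open>\<tau>\<close>, and the class of the product under conjugation by
  \<open>K\<close> singles out the orbit.\<close>

definition admissible :: "'a \<Rightarrow> (nat \<Rightarrow> 'a) \<Rightarrow> bool" where
  "admissible l X \<longleftrightarrow> X 1 \<otimes> inv \<tau> \<in> K \<and> X 1 \<in> carrier G \<and> (\<forall>i\<in>{2..t}. X i \<in> K) \<and>
     (\<exists>y\<in>K. rprod X t = y \<otimes> (l \<otimes> \<tau>) \<otimes> inv y)"

lemma admissible_carrier:
  "admissible l X \<Longrightarrow> i \<in> {1..t} \<Longrightarrow> X i \<in> carrier G"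
  by (cases "i = 1") (auto simp: admissible_def K_carrier)

text \<open>The equations saying that \<open>w\<close> moves \<open>(e, ..., e, l)\<close> to the
  given tuple can be solved one after the other, starting from \<open>w t = y\<close>. The last one,
  at index \<open>t\<close>, is exactly the conjugacy condition on the product.\<close>

lemma retwist_mem:
  assumes l: "l \<in> K" and X: "admissible l X"
  shows "retwist X \<in> twisted_rack L t \<theta> l"
proof -
  obtain y where y: "y \<in> K" and p: "rprod X t = y \<otimes> (l \<otimes> \<tau>) \<otimes> inv y"
    using X by (auto simp: admissible_def)
  have yc: "y \<in> carrier G" "l \<in> carrier G" using y l by (auto simp: K_carrier)
  have Xc: "X i \<in> carrier G" if "i \<in> {1..t}" for i using admissible_carrier[OF X that] .
  define w where "w = (\<lambda>i\<in>{1..t}. if i = t then y else rprod X i \<otimes> y \<otimes> inv \<tau>)"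
  have th: "\<tau> \<otimes> y \<otimes> inv \<tau> \<in> K"
    using theta_closed[OF y] theta[OF y] by simp
  \<comment> \<open>Membership in \<open>K\<close> propagates from index 1, where the element is the
    product of \<open>X 1 \<otimes> inv \<tau>\<close> and the conjugate
    \<open>\<tau> \<otimes> y \<otimes> inv \<tau>\<close>.\<close>
  have R: "k \<ge> 1 \<Longrightarrow> k \<le> t \<Longrightarrow> rprod X k \<otimes> y \<otimes> inv \<tau> \<in> K" for k
  proof (induction k rule: dec_induct)
    case base
    have "(X 1 \<otimes> inv \<tau>) \<otimes> (\<tau> \<otimes> y \<otimes> inv \<tau>) \<in> K"
      using th X subgroup.m_closed[OF subgroup_K] by (auto simp: admissible_def)
    then show ?case using Xc[of 1] yc tau t by (simp add: m_assoc)
  next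
    case (step k)
    have "rprod X k \<in> carrier G" using Xc step by (intro rprod_closed) auto
    moreover have "X (Suc k) \<otimes> (rprod X k \<otimes> y \<otimes> inv \<tau>) \<in> K"
      using step X subgroup.m_closed[OF subgroup_K] by (auto simp: admissible_def)
    ultimately show ?case using Xc[of "Suc k"] step yc tau by (simp add: m_assoc)
  qed
  have w: "w \<in> (\<Pi>\<^sub>E i\<in>{1..t}. K)" using R y by (auto simp: w_def)
  have wK: "w i \<in> K" "w i \<in> carrier G" if "i \<in> {1..t}" for i
    using w that by (auto simp: PiE_iff K_carrier)
  have iw: "(\<lambda>i\<in>{1..t}. inv w i) \<in> (\<Pi>\<^sub>E i\<in>{1..t}. K)"
    using w subgroup.m_inv_closed[OF subgroup_K] by (auto simp: PiE_iff)
  have tt: "t \<in> {1..t}" using t by simp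
  have "twisted_action L t \<theta> w (last_embed L t l) = retwist X"
  proof
    fix i
    show "twisted_action L t \<theta> w (last_embed L t l) i = retwist X i"
    proof (cases "i \<in> {1..t}")
      case i: True
      have act: "twisted_action L t \<theta> w (last_embed L t l) i = w i \<otimes> (if i = t then l else \<one>) \<otimes>
         (if i = 1 then \<theta> (inv w t) else inv w (i - 1))"
        using i t by (auto simp: twisted_action_def mult_power last_embed_def cyclic_twist_def inv_power[OF w])
      show ?thesis
      proof (cases "i = 1")
        case True
        have "\<theta> (inv y) = \<tau> \<otimes> inv y \<otimes> inv \<tau>"
          using y subgroup.m_inv_closed[OF subgroup_K] by (intro theta) auto
        then show ?thesis using act i True t yc tau Xc[of 1]
          by (auto simp: w_def retwist_def m_assoc)
      next
        case False
        define k where "k = i - 1"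
        have k: "i = Suc k" "k \<in> {1..t}" "k < t" using i False by (auto simp: k_def)
        have Rk: "rprod X k \<in> carrier G" using Xc k by (intro rprod_closed) auto
        show ?thesis
        proof (cases "i = t")
          case True
          have "X t \<otimes> rprod X k = y \<otimes> (l \<otimes> \<tau>) \<otimes> inv y"
            using p k True by simp
          then have e: "X t \<otimes> rprod X k \<otimes> inv rprod X k = y \<otimes> (l \<otimes> \<tau>) \<otimes> inv y \<otimes> inv rprod X k"
            by (rule arg_cong)
          have "X t \<otimes> rprod X k \<otimes> inv rprod X k = X t"
            using Rk Xc[OF tt] by (simp add: m_assoc)
          with e have Xt: "X t = y \<otimes> (l \<otimes> \<tau>) \<otimes> inv y \<otimes> inv rprod X k"
            by metis
          have "w i = y" "w (i - 1) = rprod X k \<otimes> y \<otimes> inv \<tau>" "retwist X i = X t"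
            using True k i by (auto simp: w_def retwist_def)
          then have "twisted_action L t \<theta> w (last_embed L t l) i =
              y \<otimes> l \<otimes> inv (rprod X k \<otimes> y \<otimes> inv \<tau>)"
            using act True \<open>i \<noteq> 1\<close> by simp
          also have "\<dots> = y \<otimes> (l \<otimes> \<tau>) \<otimes> inv y \<otimes> inv rprod X k"
            using yc tau Rk by (simp add: m_assoc inv_mult_group)
          finally show ?thesis using Xt \<open>retwist X i = X t\<close> by metis
        next
          case False
          then show ?thesis using act k i yc tau Xc[OF i] Rk
            by (auto simp: w_def retwist_def m_assoc inv_mult_group)
        qed
      qed
    next
      case False
      then show ?thesis by (auto simp: twisted_action_def mult_power retwist_def)
    qed
  qed
  then show ?thesis
    unfolding twisted_rack_def carrier_power using w by (metis imageI)
qed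

section \<open>Criteria for type D from invariants\<close>

lemma rack_L: "l \<in> K \<Longrightarrow> rack (twisted_op L t \<theta>) (twisted_rack L t \<theta> l)"
  using group_L t theta_auto by (intro rack_twisted_rack) auto

lemma twisted_rack_subset:
  assumes "l \<in> K" shows "twisted_rack L t \<theta> l \<subseteq> (\<Pi>\<^sub>E i\<in>{1..t}. K)"
proof -
  interpret P: group "power_group L t" using group_L by (simp add: power_group_def)
  have b: "last_embed L t l \<in> carrier (power_group L t)"
    using assms subgroup.one_closed[OF subgroup_K] by (auto simp: carrier_power last_embed_def)
  have f: "cyclic_twist t \<theta> x \<in> carrier (power_group L t)" if "x \<in> carrier (power_group L t)" for x
  proof -
    have "x i \<in> K" if "Suc 0 \<le> i" "i \<le> t" for i
      using that \<open>x \<in> _\<close> by (auto simp: carrier_power PiE_iff)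
    then show ?thesis using t by (auto simp: carrier_power cyclic_twist_def theta_closed)
  qed
  have "twisted_rack L t \<theta> l \<subseteq> carrier (power_group L t)"
    using b f by (auto simp: twisted_rack_def twisted_action_def intro!: P.m_closed)
  then show ?thesis by (simp add: carrier_power)
qed

text \<open>The displayed inequality is an entry of \<open>(rf \<cdot> sf)\<^sup>2 \<noteq> (sf \<cdot> rf)\<^sup>2\<close> in the semidirect product
  with the cyclic group generated by the twist \<open>f\<close>.\<close>

proposition type_D_invariant:
  fixes M :: "(nat \<Rightarrow> 'a) \<Rightarrow> bool" and I :: "(nat \<Rightarrow> 'a) \<Rightarrow> 'c"
  assumes l: "l \<in> K"
    and cong: "\<And>X Y. (\<And>i. i \<in> {1..t} \<Longrightarrow> X i = Y i) \<Longrightarrow> M X \<Longrightarrow> M Y \<and> I Y = I X"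
    and closed: "\<And>Y Z W. (\<And>i. i \<in> {1..t} \<Longrightarrow> W i = Y i \<otimes> Z (prev i) \<otimes> inv Y (prev i)) \<Longrightarrow>
      (\<And>i. i \<in> {1..t} \<Longrightarrow> Y i \<in> carrier G) \<Longrightarrow> (\<And>i. i \<in> {1..t} \<Longrightarrow> Z i \<in> carrier G) \<Longrightarrow>
      M Y \<Longrightarrow> M Z \<Longrightarrow> M W \<and> I W = I Z"
    and r: "admissible l r" "M r" and s: "admissible l s" "M s" and neq: "I r \<noteq> I s"
    and i: "i \<in> {1..t}"
    and sq: "r i \<otimes> s (prev i) \<otimes> r (prev (prev i)) \<otimes> s (prev (prev (prev i))) \<noteq>
      s i \<otimes> r (prev i) \<otimes> s (prev (prev i)) \<otimes> r (prev (prev (prev i)))"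
  shows "type_D (twisted_op L t \<theta>) (twisted_rack L t \<theta> l)"
proof -
  let ?X = "twisted_rack L t \<theta> l" and ?op = "twisted_op L t \<theta>"
  have XK: "?X \<subseteq> (\<Pi>\<^sub>E i\<in>{1..t}. K)" using twisted_rack_subset[OF l] .
  have opX: "?op a b \<in> ?X" if "a \<in> ?X" "b \<in> ?X" for a b
    using rack_L[OF l] that by (auto simp: rack_def bij_betw_def)
  \<comment> \<open>The two parts of the decomposition are the level sets of \<open>I\<close> at
    \<open>I r\<close> and \<open>I s\<close>. Each is stable under every level set, because
    \<open>I\<close> takes the same value at \<open>?op a b\<close> as at \<open>b\<close>.\<close>
  define T where "T J = {x \<in> ?X. M (untwist x) \<and> I (untwist x) = J}" for J
  have T: "?op a b \<in> T J" if "a \<in> T J'" "b \<in> T J" for a b J J'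
  proof -
    have a: "a \<in> ?X" "M (untwist a)" and b: "b \<in> ?X" "M (untwist b)" "I (untwist b) = J"
      using that by (auto simp: T_def)
    have "M (untwist (?op a b)) \<and> I (untwist (?op a b)) = I (untwist b)"
      using a(2) b(2) subsetD[OF XK a(1)] subsetD[OF XK b(1)]
      by (intro closed[of _ "untwist a"]) (simp_all add: untwist_twisted_op untwist_carrier)
    then show ?thesis using opX a b by (simp add: T_def)
  qed
  have rc: "r j \<in> carrier G" and sc: "s j \<in> carrier G" if "j \<in> {1..t}" for j
    using that r s admissible_carrier by blast+
  have ur: "untwist (retwist r) j = r j" and us: "untwist (retwist s) j = s j"
    if "j \<in> {1..t}" for j
    using that rc[of 1] sc[of 1] t by (auto intro!: untwist_retwist)
  have rT: "retwist r \<in> T (I r)"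
    using cong[of r "untwist (retwist r)"] ur r retwist_mem[OF l r(1)] by (auto simp: T_def)
  have sT: "retwist s \<in> T (I s)"
    using cong[of s "untwist (retwist s)"] us s retwist_mem[OF l s(1)] by (auto simp: T_def)
  have rX: "retwist r \<in> ?X" "retwist s \<in> ?X" using rT sT by (auto simp: T_def)
  have idem: "?op a a = a" if "a \<in> ?X" for a
  proof (rule untwist_eq_iff)
    show "?op a a \<in> (\<Pi>\<^sub>E i\<in>{1..t}. K)" "a \<in> (\<Pi>\<^sub>E i\<in>{1..t}. K)" using opX that XK by auto
    fix i assume i: "i \<in> {1..t}"
    have a: "a \<in> (\<Pi>\<^sub>E i\<in>{1..t}. K)" using that XK by blast
    show "untwist (?op a a) i = untwist a i"
      using untwist_carrier[OF a i] untwist_carrier[OF a prev_range[OF i]]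
      by (simp add: untwist_twisted_op[OF a a i] m_assoc)
  qed
  have "?op (retwist r) (?op (retwist s) (?op (retwist r) (retwist s))) \<noteq> retwist s"
  proof
    \<comment> \<open>Entry \<open>i\<close> of this equality, multiplied on the right by
      \<open>r\<close>, \<open>s\<close>, \<open>r\<close> at the three preceding indices, is the
      equation excluded by \<open>sq\<close>.\<close>
    assume eq: "?op (retwist r) (?op (retwist s) (?op (retwist r) (retwist s))) = retwist s"
    note pr = i prev_range[OF i] prev_range[OF prev_range[OF i]]
      prev_range[OF prev_range[OF prev_range[OF i]]]
    have m: "retwist r \<in> (\<Pi>\<^sub>E i\<in>{1..t}. K)" "retwist s \<in> (\<Pi>\<^sub>E i\<in>{1..t}. K)"
      "?op (retwist r) (retwist s) \<in> (\<Pi>\<^sub>E i\<in>{1..t}. K)"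
      "?op (retwist s) (?op (retwist r) (retwist s)) \<in> (\<Pi>\<^sub>E i\<in>{1..t}. K)"
      by (rule subsetD[OF XK], (rule rX opX)+)+
    let ?j = "prev i" let ?k = "prev ?j" let ?m = "prev ?k"
    have "r i \<otimes> (s ?j \<otimes> (r ?k \<otimes> s ?m \<otimes> inv r ?m) \<otimes> inv s ?k) \<otimes> inv r ?j = s i"
      using arg_cong[OF eq, of "\<lambda>x. untwist x i"] pr m
      by (simp add: untwist_twisted_op ur us del: atLeastAtMost_iff One_nat_def)
    then have "(r i \<otimes> (s ?j \<otimes> (r ?k \<otimes> s ?m \<otimes> inv r ?m) \<otimes> inv s ?k) \<otimes> inv r ?j)
        \<otimes> r ?j \<otimes> s ?k \<otimes> r ?m = s i \<otimes> r ?j \<otimes> s ?k \<otimes> r ?m" by simp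
    then have "r i \<otimes> s ?j \<otimes> r ?k \<otimes> s ?m = s i \<otimes> r ?j \<otimes> s ?k \<otimes> r ?m"
      using pr rc sc by (simp add: m_assoc del: atLeastAtMost_iff)
    with sq show False by blast
  qed
  then show ?thesis
    using neq rT sT T idem by (intro type_DI[where R = "T (I r)" and S = "T (I s)"]) (auto simp: T_def)
qed

text \<open>Here the invariant is the product of the entries, which lie in an abelian subgroup.\<close>

proposition type_D_commuting_conjugate:
  assumes l: "l \<in> K" and y: "y \<in> K" and \<sigma>: "\<sigma> = l \<otimes> \<tau>" and \<sigma>': "\<sigma>' = y \<otimes> \<sigma> \<otimes> inv y"
    and comm: "\<sigma> \<otimes> \<sigma>' = \<sigma>' \<otimes> \<sigma>"
    and neq: "\<sigma>' \<noteq> \<sigma>" "t = 2 \<Longrightarrow> \<sigma>' \<otimes> \<sigma>' \<noteq> \<sigma> \<otimes> \<sigma>"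
  shows "type_D (twisted_op L t \<theta>) (twisted_rack L t \<theta> l)"
proof -
  \<comment> \<open>\<open>H\<close> is the double centralizer of \<open>\<sigma>\<close> and
    \<open>\<sigma>'\<close>. Because these two commute, each element of \<open>H\<close> commutes
    with both, hence with every other element of \<open>H\<close>, so this subgroup is
    abelian.\<close>
  define H where "H = {h \<in> carrier G. \<forall>k\<in>carrier G.
    k \<otimes> \<sigma> = \<sigma> \<otimes> k \<longrightarrow> k \<otimes> \<sigma>' = \<sigma>' \<otimes> k \<longrightarrow> h \<otimes> k = k \<otimes> h}"
  define X where "X a i = (if i = 1 then a else \<one>)" for a and i :: nat
  have lc: "l \<in> carrier G" "y \<in> carrier G" using l y by (auto simp: K_carrier)
  then have \<sigma>c: "\<sigma> \<in> carrier G" "\<sigma>' \<in> carrier G" using tau by (auto simp: \<sigma> \<sigma>')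
  have \<sigma>H: "\<sigma> \<in> H" "\<sigma>' \<in> H" using \<sigma>c by (auto simp: H_def)
  have oneH: "\<one> \<in> H" by (auto simp: H_def)
  have HC: "h \<in> carrier G" if "h \<in> H" for h using that by (simp add: H_def)
  have Hm: "h \<otimes> g \<in> H" if "h \<in> H" "g \<in> H" for h g
  proof -
    have *: "h \<otimes> g \<otimes> k = k \<otimes> (h \<otimes> g)" if "k \<in> carrier G" "k \<otimes> \<sigma> = \<sigma> \<otimes> k" "k \<otimes> \<sigma>' = \<sigma>' \<otimes> k" for k
    proof -
      have "g \<otimes> k = k \<otimes> g" "h \<otimes> k = k \<otimes> h" using that \<open>h \<in> H\<close> \<open>g \<in> H\<close> by (auto simp: H_def)
      then show ?thesis using HC \<open>h \<in> H\<close> \<open>g \<in> H\<close> that(1) by (metis m_assoc)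
    qed
    have "h \<otimes> g \<in> carrier G" using HC that by simp
    with * show ?thesis unfolding H_def by blast
  qed
  have Hi: "inv h \<in> H" if "h \<in> H" for h
  proof -
    have *: "inv h \<otimes> k = k \<otimes> inv h" if "k \<in> carrier G" "k \<otimes> \<sigma> = \<sigma> \<otimes> k" "k \<otimes> \<sigma>' = \<sigma>' \<otimes> k" for k
    proof -
      have "h \<otimes> k = k \<otimes> h" using that \<open>h \<in> H\<close> by (auto simp: H_def)
      then have "k \<otimes> h = h \<otimes> k" by simp
      then show ?thesis using HC[OF \<open>h \<in> H\<close>] that(1) by (metis inv_closed inv_solve_left inv_solve_right' m_assoc m_closed)
    qed
    have "inv h \<in> carrier G" using HC that by simp
    with * show ?thesis unfolding H_def by blast
  qed
  have Hcomm: "h \<otimes> g = g \<otimes> h" if "h \<in> H" "g \<in> H" for h g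
  proof -
    have "g \<otimes> \<sigma> = \<sigma> \<otimes> g" "g \<otimes> \<sigma>' = \<sigma>' \<otimes> g" using that \<sigma>c comm by (auto simp: H_def)
    then show ?thesis using that by (auto simp: H_def)
  qed
  have H: "subgroup H G" using HC oneH Hm Hi by (intro subgroupI) auto
  have prodX: "rprod (X a) t = a" if "a \<in> carrier G" for a
  proof -
    have "rprod (X a) (Suc k) = a" for k using that by (induction k) (auto simp: X_def)
    then show ?thesis using t by (cases t) auto
  qed
  have KI: "a \<otimes> b \<in> K" if "a \<in> K" "b \<in> K" for a b
    using subgroup.m_closed[OF subgroup_K that] .
  have admX: "admissible l (X (z \<otimes> \<sigma> \<otimes> inv z))" if "z \<in> K" for z
  proof -
    have iz: "inv z \<in> K" using subgroup.m_inv_closed[OF subgroup_K that] .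
    have zc: "z \<in> carrier G" using that by (rule K_carrier)
    have "z \<otimes> l \<otimes> (\<tau> \<otimes> inv z \<otimes> inv \<tau>) \<in> K"
      using theta_closed[OF iz] theta[OF iz] that l KI by auto
    then have "z \<otimes> \<sigma> \<otimes> inv z \<otimes> inv \<tau> \<in> K" using lc tau zc by (simp add: \<sigma> m_assoc)
    moreover have "rprod (X (z \<otimes> \<sigma> \<otimes> inv z)) t = z \<otimes> \<sigma> \<otimes> inv z"
      using zc \<sigma>c by (intro prodX) auto
    ultimately show ?thesis unfolding admissible_def
      using \<sigma>c zc that subgroup.one_closed[OF subgroup_K] by (auto simp: X_def \<sigma>)
  qed
  have "admissible l (X \<sigma>)"
    using admX[of \<one>] subgroup.one_closed[OF subgroup_K] \<sigma>c by simp
  moreover have "admissible l (X \<sigma>')" using admX[OF y] \<sigma>' by simp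
  moreover have "rprod (X \<sigma>) t \<noteq> rprod (X \<sigma>') t" using prodX \<sigma>c neq by simp
  moreover have "X \<sigma> 2 \<otimes> X \<sigma>' (prev 2) \<otimes> X \<sigma> (prev (prev 2)) \<otimes> X \<sigma>' (prev (prev (prev 2))) \<noteq>
      X \<sigma>' 2 \<otimes> X \<sigma> (prev 2) \<otimes> X \<sigma>' (prev (prev 2)) \<otimes> X \<sigma> (prev (prev (prev 2)))"
  proof -
    have p: "prev 2 = 1" "prev (Suc 0) = t" by (simp_all add: prev_def)
    \<comment> \<open>Only the first entries can differ from \<open>\<one>\<close>. Among the four
      indices going back from 2, the index 1 occurs twice when \<open>t = 2\<close>, which gives
      squares, and once when \<open>t\<close> is larger.\<close>
    show ?thesis
    proof (cases "t = 2")
      case True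
      then have "X a 2 = \<one>" "X a (prev 2) = a" "X a (prev (prev 2)) = \<one>"
        "X a (prev (prev (prev 2))) = a" for a unfolding X_def prev_def by simp_all
      then show ?thesis using neq \<sigma>c True by simp
    next
      case False
      then have "prev t \<noteq> 1" "t \<noteq> 1" using t by (auto simp: prev_def)
      then show ?thesis using neq \<sigma>c by (simp add: p X_def)
    qed
  qed
  moreover have "\<forall>i\<in>{1..t}. X a i \<in> H" if "a \<in> H" for a
    using that oneH by (auto simp: X_def)
  ultimately show ?thesis
    using l t \<sigma>H
  proof (intro type_D_invariant[where M = "\<lambda>X. \<forall>i\<in>{1..t}. X i \<in> H" and I = "\<lambda>X. rprod X t" and r = "X \<sigma>"
      and s = "X \<sigma>'" and i = 2], goal_cases)
    case (2 Y Z)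
    then show ?case using rprod_cong[of t Y Z] by auto
  next
    case (3 Y Z W)
    have WH: "\<forall>i\<in>{1..t}. W i \<in> H"
      using 3 prev_range Hm Hi by metis
    have tt: "t \<in> {1..t}" using t by simp
    have c: "Y t \<otimes> inv Z t \<in> H" "rprod Z t \<in> H" using 3 tt Hm Hi rprod_subgroup[OF H] by auto
    have "rprod W t = (Y t \<otimes> inv Z t) \<otimes> rprod Z t \<otimes> inv (Y t \<otimes> inv Z t)"
      using 3 by (intro rprod_op) auto
    also have "\<dots> = rprod Z t"
      using c Hcomm[OF c] HC[OF c(1)] HC[OF c(2)] by (simp add: m_assoc)
    finally show ?case using WH by simp
  qed auto
qed

text \<open>If \<open>m\<close> divides \<open>t\<close>, then \<open>\<Sum>i. i * \<chi> (X i)\<close> is invariant modulo \<open>m\<close> under the cyclic shift on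
  tuples with \<open>\<Sum>i. \<chi> (X i) = 0\<close>, and for a fixed value of this sum the two corrections cancel.\<close>

proposition type_D_character:
  fixes \<chi> :: "'a \<Rightarrow> int" and m :: int
  assumes l: "l \<in> K" and H: "subgroup H G" and m: "m dvd int t"
    and \<chi>: "\<And>g h. g \<in> H \<Longrightarrow> h \<in> H \<Longrightarrow> [\<chi> (g \<otimes> h) = \<chi> g + \<chi> h] (mod m)"
    and r: "admissible l r" "\<And>i. i \<in> {1..t} \<Longrightarrow> r i \<in> H"
    and s: "admissible l s" "\<And>i. i \<in> {1..t} \<Longrightarrow> s i \<in> H"
    and sum: "[(\<Sum>i=1..t. \<chi> (r i)) = (\<Sum>i=1..t. \<chi> (s i))] (mod m)"
    and neq: "\<not> [(\<Sum>i=1..t. int i * \<chi> (r i)) = (\<Sum>i=1..t. int i * \<chi> (s i))] (mod m)"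
    and i: "i \<in> {1..t}"
    and sq: "r i \<otimes> s (prev i) \<otimes> r (prev (prev i)) \<otimes> s (prev (prev (prev i))) \<noteq>
      s i \<otimes> r (prev i) \<otimes> s (prev (prev i)) \<otimes> r (prev (prev (prev i)))"
  shows "type_D (twisted_op L t \<theta>) (twisted_rack L t \<theta> l)"
proof -
  define c where "c = (\<Sum>i=1..t. \<chi> (r i)) mod m"
  define M where "M X \<longleftrightarrow> (\<forall>i\<in>{1..t}. X i \<in> H) \<and> (\<Sum>i=1..t. \<chi> (X i)) mod m = c" for X
  define I where "I X = (\<Sum>i=1..t. int i * \<chi> (X i)) mod m" for X
  have \<chi>1: "[\<chi> \<one> = 0] (mod m)"
    using \<chi>[of \<one> \<one>] subgroup.one_closed[OF H] by (auto simp: cong_iff_dvd_diff)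
  have \<chi>i: "[\<chi> (inv g) = - \<chi> g] (mod m)" if "g \<in> H" for g
  proof -
    have gi: "inv g \<in> H" and gc: "g \<in> carrier G"
      using that H by (auto intro: subgroup.m_inv_closed subgroup.mem_carrier)
    have "[\<chi> g + \<chi> (inv g) = 0] (mod m)"
      using \<chi>[OF that gi] \<chi>1 gc by (simp) (metis cong_sym cong_trans)
    then show ?thesis by (simp add: cong_iff_dvd_diff add.commute)
  qed
  have shift: "(\<Sum>i=1..t. g (prev i)) = (\<Sum>i=1..t. g i)" for g :: "nat \<Rightarrow> int"
    by (rule sum.reindex_bij_witness[where i = "\<lambda>i. if i = t then 1 else Suc i" and j = prev])
      (use t in \<open>auto simp: prev_def\<close>)
  \<comment> \<open>Shifting indices raises each weight by one, except at the wrap-around, where the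
    weight is 1 instead of \<open>t + 1\<close>; these agree modulo \<open>m\<close> because
    \<open>m\<close> divides \<open>t\<close>.\<close>
  have wshift: "[(\<Sum>i=1..t. int i * g (prev i)) = (\<Sum>i=1..t. (int i + 1) * g i)] (mod m)"
    for g :: "nat \<Rightarrow> int"
  proof -
    have "[(\<Sum>i=1..t. int i * g (prev i)) = (\<Sum>i=1..t. (int (prev i) + 1) * g (prev i))] (mod m)"
    proof (rule cong_sum)
      fix i assume "i \<in> {1..t}"
      then have "[int i = int (prev i) + 1] (mod m)"
        using m by (auto simp: prev_def cong_iff_dvd_diff)
      then show "[int i * g (prev i) = (int (prev i) + 1) * g (prev i)] (mod m)"
        by (rule cong_scalar_right)
    qed
    then show ?thesis using shift[of "\<lambda>i. (int i + 1) * g i"] by simp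
  qed
  have MI: "M W \<and> I W = I Z" if W: "\<And>i. i \<in> {1..t} \<Longrightarrow> W i = Y i \<otimes> Z (prev i) \<otimes> inv Y (prev i)"
    and Y: "M Y" and Z: "M Z" for Y Z W
  proof -
    have h: "Y i \<in> H" "Z i \<in> H" "inv Y i \<in> H" if "i \<in> {1..t}" for i
      using Y Z that H by (auto simp: M_def intro: subgroup.m_inv_closed)
    have \<chi>W: "[\<chi> (W i) = \<chi> (Y i) + \<chi> (Z (prev i)) - \<chi> (Y (prev i))] (mod m)" if i: "i \<in> {1..t}" for i
    proof -
      note j = prev_range[OF i]
      have "[\<chi> (W i) = \<chi> (Y i \<otimes> Z (prev i)) + \<chi> (inv Y (prev i))] (mod m)"
        using h[OF i] h[OF j] by (auto simp: W[OF i] intro!: \<chi> subgroup.m_closed[OF H])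
      also have "[\<chi> (Y i \<otimes> Z (prev i)) + \<chi> (inv Y (prev i)) = (\<chi> (Y i) + \<chi> (Z (prev i))) + - \<chi> (Y (prev i))] (mod m)"
        using h[OF i] h[OF j] by (intro cong_add \<chi> \<chi>i) auto
      finally show ?thesis by simp
    qed
    have "[(\<Sum>i=1..t. \<chi> (W i)) = (\<Sum>i=1..t. \<chi> (Y i) + \<chi> (Z (prev i)) - \<chi> (Y (prev i)))] (mod m)"
      by (intro cong_sum \<chi>W)
    also have "(\<Sum>i=1..t. \<chi> (Y i) + \<chi> (Z (prev i)) - \<chi> (Y (prev i))) = (\<Sum>i=1..t. \<chi> (Z i))"
      using shift[of "\<lambda>i. \<chi> (Y i)"] shift[of "\<lambda>i. \<chi> (Z i)"]
      by (simp add: sum.distrib sum_subtractf)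
    finally have sumW: "[(\<Sum>i=1..t. \<chi> (W i)) = (\<Sum>i=1..t. \<chi> (Z i))] (mod m)" .
    have "[(\<Sum>i=1..t. int i * \<chi> (W i)) =
        (\<Sum>i=1..t. int i * (\<chi> (Y i) + \<chi> (Z (prev i)) - \<chi> (Y (prev i))))] (mod m)"
      by (intro cong_sum cong_scalar_left \<chi>W)
    also have "(\<Sum>i=1..t. int i * (\<chi> (Y i) + \<chi> (Z (prev i)) - \<chi> (Y (prev i)))) =
      (\<Sum>i=1..t. int i * \<chi> (Y i)) + (\<Sum>i=1..t. int i * \<chi> (Z (prev i))) - (\<Sum>i=1..t. int i * \<chi> (Y (prev i)))"
      by (simp add: algebra_simps sum.distrib sum_subtractf)
    also have "[\<dots> = (\<Sum>i=1..t. int i * \<chi> (Y i)) + (\<Sum>i=1..t. (int i + 1) * \<chi> (Z i))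
        - (\<Sum>i=1..t. (int i + 1) * \<chi> (Y i))] (mod m)"
      by (intro cong_add cong_diff cong_refl wshift)
    also have "(\<Sum>i=1..t. int i * \<chi> (Y i)) + (\<Sum>i=1..t. (int i + 1) * \<chi> (Z i))
        - (\<Sum>i=1..t. (int i + 1) * \<chi> (Y i)) =
      (\<Sum>i=1..t. int i * \<chi> (Z i)) + ((\<Sum>i=1..t. \<chi> (Z i)) - (\<Sum>i=1..t. \<chi> (Y i)))"
      by (simp add: algebra_simps sum.distrib sum_subtractf)
    also have "[\<dots> = (\<Sum>i=1..t. int i * \<chi> (Z i)) + 0] (mod m)"
    proof (intro cong_add cong_refl)
      have "[(\<Sum>i=1..t. \<chi> (Z i)) = (\<Sum>i=1..t. \<chi> (Y i))] (mod m)"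
        using Y Z by (simp add: M_def cong_def)
      then show "[(\<Sum>i=1..t. \<chi> (Z i)) - (\<Sum>i=1..t. \<chi> (Y i)) = 0] (mod m)"
        by (simp add: cong_iff_dvd_diff)
    qed
    finally have "[(\<Sum>i=1..t. int i * \<chi> (W i)) = (\<Sum>i=1..t. int i * \<chi> (Z i))] (mod m)" by simp
    moreover have "W i \<in> H" if "i \<in> {1..t}" for i
      using h[OF that] h[OF prev_range[OF that]] by (auto simp: W[OF that] intro!: subgroup.m_closed[OF H])
    ultimately show ?thesis using sumW Z by (auto simp: M_def I_def cong_def)
  qed
  show ?thesis
  proof (rule type_D_invariant[where M = M and I = I and r = r and s = s, OF l _ _ r(1) _ s(1) _ _ i sq])
    show "M Y \<and> I Y = I X" if "\<And>i. i \<in> {1..t} \<Longrightarrow> X i = Y i" "M X" for X Y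
      using that sum.cong[of "{1..t}" "{1..t}" "\<lambda>i. \<chi> (X i)" "\<lambda>i. \<chi> (Y i)"]
        sum.cong[of "{1..t}" "{1..t}" "\<lambda>i. int i * \<chi> (X i)" "\<lambda>i. int i * \<chi> (Y i)"]
      by (auto simp: M_def I_def)
    show "M r" "M s" using r s sum by (auto simp: M_def c_def cong_def)
    show "I r \<noteq> I s" using neq by (auto simp: I_def cong_def)
  qed (rule MI)
qed

end


section \<open>Orbits and commuting conjugates\<close>

lemma evenperm_cycle_of_list:
  "distinct cs \<Longrightarrow> cs \<noteq> [] \<Longrightarrow> evenperm (cycle_of_list cs) \<longleftrightarrow> odd (length cs)"
  by (induction cs rule: cycle_of_list.induct)
    (auto simp: evenperm_comp permutation_of_cycle permutation_swap_id evenperm_swap)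

lemma orbit_eq_support: "permutation p \<Longrightarrow> orbit p x = set (support p x)"
  unfolding support_set orbit_altdef_permutation by auto

lemma card_orbit: "permutation p \<Longrightarrow> card (orbit p x) = least_power p x"
  using cycle_of_permutation[of p x] distinct_card[of "support p x"]
  by (simp add: orbit_eq_support del: set_map)

lemma card_orbit_pos: "permutation p \<Longrightarrow> 0 < card (orbit p x)"
  by (simp add: card_orbit least_power_of_permutation)

lemma finite_orbit_permutation: "permutation p \<Longrightarrow> finite (orbit p x)"
  by (simp add: orbit_eq_support)

lemma funpow_eq_iff_cong:
  assumes "permutation p"
  shows "(p ^^ a) x = (p ^^ b) x \<longleftrightarrow> [a = b] (mod card (orbit p x))"
proof -
  have *: "(p ^^ a) x = (p ^^ b) x \<longleftrightarrow> [a = b] (mod card (orbit p x))" if "a \<le> b" for a b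
  proof -
    have "inj (p ^^ a)" using assms by (intro inj_fn) (simp add: bij_is_inj permutation)
    have "(p ^^ b) x = (p ^^ a) ((p ^^ (b - a)) x)"
      using that funpow_add[of a "b - a" p] by simp
    then have "(p ^^ a) x = (p ^^ b) x \<longleftrightarrow> (p ^^ (b - a)) x = x"
      using injD[OF \<open>inj (p ^^ a)\<close>, of x "(p ^^ (b - a)) x"] by metis
    also have "\<dots> \<longleftrightarrow> [b = a] (mod card (orbit p x))"
      using that by (simp add: least_power_dvd[OF assms, symmetric] card_orbit[OF assms] cong_altdef_nat)
    finally show ?thesis by (simp add: cong_sym_eq)
  qed
  show ?thesis
    using *[of a b] *[of b a] by (cases "a \<le> b") (auto simp: cong_sym_eq)
qed

lemma in_orbit_step_iff: "permutation p \<Longrightarrow> p y \<in> orbit p x \<longleftrightarrow> y \<in> orbit p x"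
  by (metis orbit.step orbit_swap permutation_orbit_step permutation_self_in_orbit orbit_trans)

lemma bij_betw_orbit:
  assumes "permutation p" shows "bij_betw p (orbit p x) (orbit p x)"
proof -
  have "inj_on p (orbit p x)" using assms by (auto simp: permutation bij_def intro: inj_on_subset)
  moreover have "p ` orbit p x \<subseteq> orbit p x" using in_orbit_step_iff[OF assms] by auto
  ultimately show ?thesis
    using endo_inj_surj[OF finite_orbit_permutation[OF assms]] by (auto simp: bij_betw_def)
qed

lemma evenperm_restrict_orbit:
  assumes p: "permutation p"
  shows "evenperm (restrict_id p (orbit p x)) \<longleftrightarrow> odd (card (orbit p x))"
proof -
  have "restrict_id p (orbit p x) = cycle_of_list (support p x)"
  proof
    fix y show "restrict_id p (orbit p x) y = cycle_of_list (support p x) y"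
      using cycle_restrict[OF p, of y x] id_outside_supp[of y "support p x"]
      by (cases "y \<in> orbit p x") (simp_all add: orbit_eq_support[OF p] del: set_map)
  qed
  then show ?thesis
    using evenperm_cycle_of_list[OF cycle_of_permutation[OF p], of x] least_power_of_permutation[OF p, of x]
    by (simp add: card_orbit[OF p])
qed

text \<open>Multiplication by \<open>j\<close> on the exponents, taking \<open>(p ^^ n) x\<close> to
  \<open>(p ^^ (j * n)) x\<close>, permutes the cycle because \<open>j\<close> is a unit modulo its
  length, and it carries \<open>p\<close> to \<open>p ^^ j\<close> there.\<close>

lemma conj_power_on_orbit:
  fixes p :: "'a \<Rightarrow> 'a" and x :: 'a
  defines "C \<equiv> orbit p x"
  assumes p: "permutation p" and j: "coprime j (card C)"
  obtains u where "u permutes C"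
    "\<And>y. (u \<circ> p \<circ> inv' u) y = (if y \<in> C then (p ^^ j) y else p y)"
proof -
  \<comment> \<open>The exponent is determined only modulo the length of the cycle, but this already
    determines \<open>(p ^^ (j * k y)) x\<close>.\<close>
  define k where "k y = (SOME k. (p ^^ k) x = y)" for y
  define u where "u y = (if y \<in> C then (p ^^ (j * k y)) x else y)" for y
  have C: "C = {(p ^^ n) x | n. True}" unfolding C_def using p by (rule orbit_altdef_permutation)
  have k: "(p ^^ k y) x = y" if "y \<in> C" for y
  proof -
    have "\<exists>n. (p ^^ n) x = y" using that unfolding C by blast
    then show ?thesis unfolding k_def by (rule someI_ex)
  qed
  have xO: "(p ^^ n) x \<in> C" for n unfolding C by blast
  have u: "u ((p ^^ n) x) = (p ^^ (j * n)) x" for n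
  proof -
    have "[k ((p ^^ n) x) = n] (mod card C)"
      unfolding C_def using k[OF xO] by (simp flip: funpow_eq_iff_cong[OF p])
    then have "(p ^^ (j * k ((p ^^ n) x))) x = (p ^^ (j * n)) x"
      unfolding C_def by (simp add: funpow_eq_iff_cong[OF p] cong_scalar_left)
    then show ?thesis using xO by (simp add: u_def)
  qed
  have "inj_on u C"
  proof (rule inj_onI)
    fix y z assume yz: "y \<in> C" "z \<in> C" "u y = u z"
    then have "[j * k y = j * k z] (mod card C)"
      unfolding C_def by (simp add: u_def C_def funpow_eq_iff_cong[OF p])
    then have "[k y = k z] (mod card C)" using j by (simp add: cong_mult_lcancel_nat)
    then show "y = z" using k yz by (metis C_def funpow_eq_iff_cong[OF p])
  qed
  moreover have "u ` C \<subseteq> C" using xO by (auto simp: u_def)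
  ultimately have "bij_betw u C C"
    using endo_inj_surj[of C u] finite_orbit_permutation[OF p, of x] by (auto simp: bij_betw_def C_def)
  then have uO: "u permutes C" by (rule bij_imp_permutes) (simp add: u_def)
  have "u (p (inv' u y)) = (if y \<in> C then (p ^^ j) y else p y)" for y
  proof (cases "y \<in> C")
    case True
    then have "inv' u y \<in> C" using permutes_in_image[OF permutes_inv[OF uO]] by simp
    then obtain n where n: "inv' u y = (p ^^ n) x" unfolding C by blast
    then have y: "y = (p ^^ (j * n)) x" using u permutes_inverses(1)[OF uO] by metis
    have "u (p (inv' u y)) = u ((p ^^ Suc n) x)" by (simp add: n)
    also have "\<dots> = (p ^^ (j * Suc n)) x" by (rule u)
    also have "\<dots> = (p ^^ j) y" by (simp add: y funpow_add)
    finally show ?thesis using True by simp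
  next
    case False
    moreover have "p y \<notin> C" using False by (simp add: C_def in_orbit_step_iff[OF p])
    moreover have "inv' u y = y" using permutes_not_in[OF permutes_inv[OF uO]] False by blast
    ultimately show ?thesis by (simp add: u_def)
  qed
  then show thesis using that[OF uO] by simp
qed

lemma commute_power_on_invariant:
  assumes "\<And>y. p y \<in> T \<longleftrightarrow> y \<in> T" and q: "\<And>y. q y = (if y \<in> T then (p ^^ j) y else p y)"
  shows "p \<circ> q = q \<circ> p"
proof
  fix y
  have "(p ^^ j) y \<in> T \<longleftrightarrow> y \<in> T" using assms(1) by (induction j) auto
  then show "(p \<circ> q) y = (q \<circ> p) y" using assms by (simp add: funpow_swap1)
qed

lemma conj_comp_inv:
  assumes "bij u" "bij v"
  shows "(u \<circ> v) \<circ> p \<circ> inv' (u \<circ> v) = u \<circ> (v \<circ> p \<circ> inv' v) \<circ> inv' u"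
  using assms by (simp add: o_inv_distrib comp_assoc)

lemma conj_commuting:
  assumes "bij c" "c \<circ> p = p \<circ> c"
  shows "c \<circ> p \<circ> inv' c = p"
  using assms by (simp add: comp_assoc) (metis bij_is_surj comp_assoc comp_id surj_iff)

text \<open>A cycle of even length of \<open>p\<close>, taken by itself, is an odd permutation that
  commutes with \<open>p\<close>.\<close>

lemma exists_odd_commuting:
  assumes p: "p permutes S" and "finite S" and x: "x \<in> S" "even (card (orbit p x))"
  obtains c where "c permutes S" "\<not> evenperm c" "c \<circ> p = p \<circ> c"
proof
  have pp: "permutation p" using assms by (auto simp: permutation_permutes)
  show "restrict_id p (orbit p x) permutes S"
    using permutes_restrict_id[OF bij_betw_orbit[OF pp]] permutes_orbit_subset[OF p x(1)]
    by (rule permutes_subset)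
  show "\<not> evenperm (restrict_id p (orbit p x))" using x pp by (simp add: evenperm_restrict_orbit)
  show "restrict_id p (orbit p x) \<circ> p = p \<circ> restrict_id p (orbit p x)"
    using in_orbit_step_iff[OF pp] by (auto simp: fun_eq_iff restrict_id_def)
qed

text \<open>Composing an odd conjugator with an odd element of the centralizer of \<open>p\<close>
  makes it even and does not change the conjugate.\<close>

lemma exists_even_conjugator:
  assumes S: "finite S" and p: "p permutes S" and u: "u permutes S"
    and c: "c permutes S" "\<not> evenperm c" "c \<circ> p = p \<circ> c"
  obtains v where "v permutes S" "evenperm v" "v \<circ> p \<circ> inv' v = u \<circ> p \<circ> inv' u"
proof (cases "evenperm u")
  case True
  with u that show ?thesis by blast
next
  case False
  have "evenperm (u \<circ> c)" using False c u S
    by (subst evenperm_comp) (auto intro: permutes_imp_permutation)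
  moreover have "(u \<circ> c) \<circ> p \<circ> inv' (u \<circ> c) = u \<circ> p \<circ> inv' u"
    using conj_comp_inv[OF permutes_bij[OF u] permutes_bij[OF c(1)]]
      conj_commuting[OF permutes_bij[OF c(1)] c(3)] by metis
  ultimately show ?thesis using that[of "u \<circ> c"] permutes_compose[OF c(1) u] by blast
qed

text \<open>Prepares the use of \<open>type_D_commuting_conjugate\<close>; that \<open>q\<close>, or
  its square, differs from that of \<open>p\<close> is left to the individual constructions.\<close>

definition alt_commuting_conj :: "'a set \<Rightarrow> ('a \<Rightarrow> 'a) \<Rightarrow> ('a \<Rightarrow> 'a) \<Rightarrow> bool" where
  "alt_commuting_conj S p q \<longleftrightarrow>
     (\<exists>u. u permutes S \<and> evenperm u \<and> q = u \<circ> p \<circ> inv' u) \<and> p \<circ> q = q \<circ> p"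

text \<open>\<open>q\<close> inverts one cycle of \<open>p\<close> and agrees with \<open>p\<close>
  elsewhere. The exponent \<open>card (orbit p x) - 1\<close> stands for -1 and is coprime to the
  length; the odd element \<open>c\<close> of the centralizer provides an even conjugator.\<close>

lemma alt_commuting_conj_inverse_on_orbit:
  assumes S: "finite S" and p: "p permutes S" and c: "c permutes S" "\<not> evenperm c" "c \<circ> p = p \<circ> c"
    and x: "x \<in> S"
  obtains q where "alt_commuting_conj S p q" "q x = (p ^^ (card (orbit p x) - 1)) x"
    "q (q x) = (p ^^ (2 * (card (orbit p x) - 1))) x"
proof -
  let ?O = "orbit p x" let ?j = "card ?O - 1"
  have pp: "permutation p" using S p by (auto simp: permutation_permutes)
  have "coprime ?j (card ?O)" using card_orbit_pos[OF pp, of x] by (intro coprime_diff_one_left_nat)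
  then obtain u where u: "u permutes ?O"
    "\<And>y. (u \<circ> p \<circ> inv' u) y = (if y \<in> ?O then (p ^^ ?j) y else p y)"
    using conj_power_on_orbit[OF pp] by blast
  have uS: "u permutes S" using u(1) permutes_orbit_subset[OF p x] by (rule permutes_subset)
  obtain v where v: "v permutes S" "evenperm v" "v \<circ> p \<circ> inv' v = u \<circ> p \<circ> inv' u"
    using exists_even_conjugator[OF S p uS c] .
  let ?q = "u \<circ> p \<circ> inv' u"
  have "p \<circ> ?q = ?q \<circ> p" using in_orbit_step_iff[OF pp] u(2) by (rule commute_power_on_invariant)
  then have "alt_commuting_conj S p ?q" using v unfolding alt_commuting_conj_def by metis
  moreover have xO: "x \<in> ?O" using pp by (rule permutation_self_in_orbit)
  moreover have "(p ^^ ?j) x \<in> ?O" using xO by (rule funpow_in_orbit)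
  ultimately show ?thesis using that[of ?q] u(2) by (simp add: mult_2 funpow_add)
qed

text \<open>A conjugator \<open>u\<close> taking \<open>p\<close> to \<open>p\<^sup>2\<close> on the orbit may be odd, but its square is even.\<close>

lemma alt_commuting_conj_fourth_power:
  assumes S: "finite S" and p: "p permutes S" and x: "x \<in> S" "odd (card (orbit p x))"
  obtains q where "alt_commuting_conj S p q" "q x = (p ^^ 4) x" "q (q x) = (p ^^ 8) x"
proof -
  let ?O = "orbit p x"
  have pp: "permutation p" using S p by (auto simp: permutation_permutes)
  have "coprime 2 (card ?O)" using x by simp
  then obtain u where u: "u permutes ?O"
    "\<And>y. (u \<circ> p \<circ> inv' u) y = (if y \<in> ?O then (p ^^ 2) y else p y)"
    using conj_power_on_orbit[OF pp] by blast
  have uS: "u permutes S" using u(1) permutes_orbit_subset[OF p x(1)] by (rule permutes_subset)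
  let ?q1 = "u \<circ> p \<circ> inv' u" let ?q = "u \<circ> ?q1 \<circ> inv' u"
  \<comment> \<open>On the orbit \<open>u\<close> intertwines \<open>p\<close> with
    \<open>p ^^ 2\<close>, so conjugating by it twice multiplies the exponent by 4.\<close>
  have q: "?q y = (if y \<in> ?O then (p ^^ 4) y else p y)" for y
  proof (cases "y \<in> ?O")
    case True
    then have iy: "inv' u y \<in> ?O" using permutes_in_image[OF permutes_inv[OF u(1)]] by simp
    have e: "u (p z) = (p ^^ 2) (u z)" if "z \<in> ?O" for z
      using u(2)[of "u z"] that permutes_in_image[OF u(1)] permutes_inverses[OF u(1)] by simp
    have "?q y = u ((p ^^ 2) (inv' u y))" using u(2)[of "inv' u y"] iy by simp
    also have "\<dots> = (p ^^ 2) ((p ^^ 2) (u (inv' u y)))"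
      using e[OF iy] e[of "p (inv' u y)"] iy in_orbit_step_iff[OF pp, of "inv' u y" x]
      by (simp add: numeral_2_eq_2)
    also have "\<dots> = (p ^^ 4) y" using permutes_inverses[OF u(1)] by (simp add: numeral_eq_Suc)
    finally show ?thesis using True by simp
  next
    case False
    then have "inv' u y = y" "u (p y) = p y" "inv' u (inv' u y) = y"
      using permutes_not_in[OF permutes_inv[OF u(1)]] permutes_not_in[OF u(1)] in_orbit_step_iff[OF pp] by auto
    then show ?thesis using False by simp
  qed
  have uu: "evenperm (u \<circ> u)" "(u \<circ> u) permutes S"
    using uS S by (auto simp: evenperm_comp permutes_imp_permutation permutes_compose)
  have "(u \<circ> u) \<circ> p \<circ> inv' (u \<circ> u) = ?q" using u(1) by (intro conj_comp_inv) (auto simp: permutes_bij)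
  moreover have "p \<circ> ?q = ?q \<circ> p" using in_orbit_step_iff[OF pp] q by (rule commute_power_on_invariant)
  ultimately have "alt_commuting_conj S p ?q" using uu unfolding alt_commuting_conj_def by metis
  moreover have "x \<in> ?O" using pp by (rule permutation_self_in_orbit)
  moreover have "(p ^^ 4) x \<in> ?O" using calculation(2) by (rule funpow_in_orbit)
  ultimately show ?thesis using that[of ?q] q funpow_add[of 4 4 p] by simp
qed

section \<open>Explicit conjugates for permutations of order two and three\<close>

lemma alt_commuting_conjI:
  assumes u: "u permutes S" "evenperm u" and q: "\<And>w. q (u w) = u (p w)" "\<And>w. p (q w) = q (p w)"
  shows "alt_commuting_conj S p q"
proof -
  have "q = u \<circ> p \<circ> inv' u"
  proof
    fix w show "q w = (u \<circ> p \<circ> inv' u) w"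
      using q(1)[of "inv' u w"] permutes_inverses(1)[OF u(1)] by simp
  qed
  with u q show ?thesis unfolding alt_commuting_conj_def by (auto simp: fun_eq_iff)
qed

lemma transpose_comp_permutes:
  assumes "{a, b, c, d} \<subseteq> S" "a \<noteq> b" "c \<noteq> d"
  shows "(transpose a b \<circ> transpose c d) permutes S" "evenperm (transpose a b \<circ> transpose c d)"
  using assms
  by (auto simp: permutes_compose permutes_swap_id evenperm_comp permutation_swap_id evenperm_swap)

lemma exists_two_outside:
  assumes "finite T" "finite S" "card T + 2 \<le> card S"
  obtains a b where "a \<in> S - T" "b \<in> S - T" "a \<noteq> b"
proof -
  have "2 \<le> card (S - T)" using assms diff_card_le_card_Diff[of T S] by linarith
  then obtain U where "U \<subseteq> S - T" "card U = 2" by (meson obtain_subset_with_card_n)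
  then show thesis using that by (auto simp: card_2_iff)
qed

text \<open>A 3-cycle is inverted by an odd conjugator, the transposition of two of its points. A
  second transposition restores evenness: it inverts another 3-cycle or, if there is none, swaps two
  fixed points, which exist since \<open>S\<close> has at least five points.\<close>

lemma alt_commuting_conj_order_3:
  assumes S: "finite S" "5 \<le> card S" and p: "p permutes S" "\<And>w. p (p (p w)) = w" and x: "p x \<noteq> x"
  obtains q where "alt_commuting_conj S p q" "q (q x) \<noteq> p (p x)"
proof -
  have inj: "p v = p w \<longleftrightarrow> v = w" for v w using p(2) by metis
  have mem: "p w \<in> S \<longleftrightarrow> w \<in> S" for w using permutes_in_image[OF p(1)] .
  have supp: "w \<in> S" if "p w \<noteq> w" for w using that permutes_not_in[OF p(1)] by blast
  define y z where "y = p x" and "z = p y"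
  have xyz: "p x = y" "p y = z" "p z = x" "x \<noteq> y" "y \<noteq> z" "x \<noteq> z" "x \<in> S" "y \<in> S" "z \<in> S"
    using x p(2) supp mem inj by (auto simp: y_def z_def) metis
  show thesis
  proof (cases "\<exists>a. a \<notin> {x, y, z} \<and> p a \<noteq> a")
    case True
    then obtain a where a: "a \<notin> {x, y, z}" "p a \<noteq> a" by blast
    define b c where "b = p a" and "c = p b"
    have abc: "p a = b" "p b = c" "p c = a" "a \<noteq> b" "b \<noteq> c" "a \<noteq> c" "a \<in> S" "b \<in> S" "c \<in> S"
      using a p(2) supp mem inj by (auto simp: b_def c_def) metis
    have "p ` {x, y, z} = {x, y, z}" unfolding image_insert xyz image_empty by blast
    then have "p w \<notin> {x, y, z}" if "w \<notin> {x, y, z}" for w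
      using inj_image_mem_iff[OF permutes_inj[OF p(1)]] that by metis
    then have "b \<notin> {x, y, z}" "c \<notin> {x, y, z}" unfolding b_def c_def using a(1) by blast+
    then have disj: "{a, b, c} \<inter> {x, y, z} = {}" using a by blast
    define T where "T = {x, y, z, a, b, c}"
    define q where "q w = (if w \<in> T then p (p w) else p w)" for w
    have "p ` T = T" unfolding T_def image_insert xyz abc image_empty by blast
    then have T: "p w \<in> T \<longleftrightarrow> w \<in> T" for w
      using inj_image_mem_iff[OF permutes_inj[OF p(1)]] by metis
    have "alt_commuting_conj S p q"
    proof (rule alt_commuting_conjI)
      show "(transpose y z \<circ> transpose b c) permutes S" "evenperm (transpose y z \<circ> transpose b c)"
        using xyz abc by (auto intro!: transpose_comp_permutes)
      show "p (q w) = q (p w)" for w using T by (auto simp: q_def)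
      show "q ((transpose y z \<circ> transpose b c) w) = (transpose y z \<circ> transpose b c) (p w)" for w
      proof (cases "w \<in> T")
        case True
        then show ?thesis using xyz abc disj by (auto simp: T_def q_def transpose_def)
      next
        case False
        then have "w \<notin> T" "p w \<notin> T" using T by auto
        then show ?thesis by (auto simp: T_def q_def transpose_def)
      qed
    qed
    moreover have "q (q x) \<noteq> p (p x)" using xyz by (simp add: q_def T_def)
    ultimately show ?thesis using that by blast
  next
    case False
    have "card {x, y, z} \<le> 3" by (simp add: card_insert_if)
    then obtain a b where ab: "a \<in> S - {x, y, z}" "b \<in> S - {x, y, z}" "a \<noteq> b"
      using exists_two_outside[of "{x, y, z}" S] S by auto
    define q where "q w = (if w \<in> {x, y, z} then p (p w) else p w)" for w
    have fixed: "p w = w" if "w \<notin> {x, y, z}" for w using False that by blast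
    have "alt_commuting_conj S p q"
    proof (rule alt_commuting_conjI)
      show "(transpose y z \<circ> transpose a b) permutes S" "evenperm (transpose y z \<circ> transpose a b)"
        using xyz ab by (auto intro!: transpose_comp_permutes)
      show "p (q w) = q (p w)" for w using xyz fixed[of w] by (auto simp: q_def)
      show "q ((transpose y z \<circ> transpose a b) w) = (transpose y z \<circ> transpose a b) (p w)" for w
      proof (cases "w \<in> {x, y, z}")
        case True
        then show ?thesis using xyz ab by (auto simp: q_def transpose_def)
      next
        case False
        then show ?thesis using ab fixed[of w] fixed[of a] fixed[of b] by (auto simp: q_def transpose_def)
      qed
    qed
    moreover have "q (q x) \<noteq> p (p x)" using xyz by (simp add: q_def)
    ultimately show ?thesis using that by blast
  qed
qed

text \<open>Two transpositions \<open>(x y)(a b)\<close> are replaced by \<open>(x a)(y b)\<close>,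
  which lies in the same Klein four-group, by means of a 3-cycle. A single transposition
  \<open>(x y)\<close> is moved to a disjoint one by \<open>(x a)(y b)\<close>.\<close>

lemma alt_commuting_conj_involution:
  assumes S: "finite S" "5 \<le> card S" and p: "p permutes S" "\<And>w. p (p w) = w" and x: "p x \<noteq> x"
  obtains q where "alt_commuting_conj S p q" "q \<noteq> p"
proof -
  have inj: "p v = p w \<longleftrightarrow> v = w" for v w using p(2) by metis
  have mem: "p w \<in> S \<longleftrightarrow> w \<in> S" for w using permutes_in_image[OF p(1)] .
  have supp: "w \<in> S" if "p w \<noteq> w" for w using that permutes_not_in[OF p(1)] by blast
  define y where "y = p x"
  have xy: "p x = y" "p y = x" "x \<noteq> y" "x \<in> S" "y \<in> S"
    using x p(2) supp mem by (auto simp: y_def)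
  show thesis
  proof (cases "\<exists>a. a \<notin> {x, y} \<and> p a \<noteq> a")
    case True
    then obtain a where a: "a \<notin> {x, y}" "p a \<noteq> a" by blast
    define b where "b = p a"
    have ab: "p a = b" "p b = a" "a \<noteq> b" "a \<in> S" "b \<in> S"
      using a p(2) supp mem by (auto simp: b_def)
    have disj: "a \<noteq> x" "a \<noteq> y" "b \<noteq> x" "b \<noteq> y" using a xy ab by auto
    define q where "q w = (if w = x then a else if w = a then x else if w = y then b
      else if w = b then y else p w)" for w
    have out: "p w \<notin> {x, y, a, b}" if "w \<notin> {x, y, a, b}" for w using that xy ab p(2)[of w] by auto
    have "alt_commuting_conj S p q"
    proof (rule alt_commuting_conjI)
      show "(transpose y a \<circ> transpose a b) permutes S" "evenperm (transpose y a \<circ> transpose a b)"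
        using xy ab disj by (auto intro!: transpose_comp_permutes)
      show "p (q w) = q (p w)" for w
        using xy ab disj out[of w] by (cases "w \<in> {x, y, a, b}") (auto simp: q_def)
      show "q ((transpose y a \<circ> transpose a b) w) = (transpose y a \<circ> transpose a b) (p w)" for w
        using xy ab disj out[of w] by (cases "w \<in> {x, y, a, b}") (auto simp: q_def transpose_def)
    qed
    moreover have "q x \<noteq> p x" using xy disj by (simp add: q_def)
    ultimately show ?thesis using that by metis
  next
    case False
    have "card {x, y} \<le> 2" by (simp add: card_insert_if)
    then obtain a b where ab: "a \<in> S - {x, y}" "b \<in> S - {x, y}" "a \<noteq> b"
      using exists_two_outside[of "{x, y}" S] S by auto
    have fixed: "p w = w" if "w \<notin> {x, y}" for w using False that by blast
    have "alt_commuting_conj S p (transpose a b)"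
    proof (rule alt_commuting_conjI)
      show "(transpose x a \<circ> transpose y b) permutes S" "evenperm (transpose x a \<circ> transpose y b)"
        using xy ab by (auto intro!: transpose_comp_permutes)
      show "p (transpose a b w) = transpose a b (p w)" for w
      proof (cases "w \<in> {x, y}")
        case True
        then show ?thesis using xy ab by (auto simp: transpose_def)
      next
        case False
        then show ?thesis using fixed[OF False] fixed[of a] fixed[of b] ab by (auto simp: transpose_def)
      qed
      show "transpose a b ((transpose x a \<circ> transpose y b) w) = (transpose x a \<circ> transpose y b) (p w)" for w
      proof (cases "w \<in> {x, y}")
        case True
        then show ?thesis using xy ab by (auto simp: transpose_def)
      next
        case False
        then show ?thesis using fixed[OF False] xy(3) ab by (auto simp: transpose_def)
      qed
    qed
    moreover have "transpose a b x \<noteq> p x" using xy ab by auto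
    ultimately show ?thesis using that by metis
  qed
qed

section \<open>Existence of commuting conjugates by cycle lengths\<close>

lemma funpow_card_orbit_multiple:
  assumes "permutation p" "card (orbit p x) dvd k"
  shows "(p ^^ k) x = x"
  using assms by (simp add: card_orbit least_power_dvd)

text \<open>If some cycle has even length, the parity of conjugators can be corrected and the cycle
  of \<open>x\<close> is inverted. Otherwise the fourth power on a cycle of length at least 5 works,
  and what remains has order 3.\<close>

lemma alt_commuting_conj_square_neq:
  assumes S: "finite S" "5 \<le> card S" and p: "p permutes S"
    and x: "x \<in> S" "card (orbit p x) \<notin> {1, 2, 4}"
  obtains q where "alt_commuting_conj S p q" "q \<circ> q \<noteq> p \<circ> p"
proof -
  have pp: "permutation p" using S p by (auto simp: permutation_permutes)
  show thesis
  proof (cases "\<exists>w\<in>S. even (card (orbit p w))")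
    case True
    then obtain c where c: "c permutes S" "\<not> evenperm c" "c \<circ> p = p \<circ> c"
      using exists_odd_commuting[OF p S(1)] by metis
    let ?m = "card (orbit p x)"
    obtain q where q: "alt_commuting_conj S p q" "q (q x) = (p ^^ (2 * (?m - 1))) x"
      using alt_commuting_conj_inverse_on_orbit[OF S(1) p c x(1)] by metis
    have "q (q x) \<noteq> p (p x)"
    proof
      assume "q (q x) = p (p x)"
      then have "(p ^^ (2 * (?m - 1))) x = (p ^^ 2) x" using q by (simp add: numeral_2_eq_2)
      then have "[2 * (?m - 1) = 2] (mod ?m)" by (simp only: funpow_eq_iff_cong[OF pp])
      \<comment> \<open>The congruence says that -2 and 2 agree modulo the length; adding 2 removes
        the truncated subtraction and shows that the length divides 4.\<close>
      then have "[2 * (?m - 1) + 2 = 2 + 2] (mod ?m)" by (intro cong_add cong_refl)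
      moreover have "2 * (?m - 1) + 2 = ?m * 2" using card_orbit_pos[OF pp, of x] by simp
      ultimately have "[0 = 4] (mod ?m)" by (simp add: cong_def)
      then have "?m dvd 4" using cong_0_iff cong_sym by blast
      then have "?m \<le> 4" "?m dvd 4" by (auto dest: dvd_imp_le)
      moreover have "?m = 3" using calculation x card_orbit_pos[OF pp, of x] by auto
      ultimately show False by simp
    qed
    then show ?thesis using that[OF q(1)] by (metis comp_apply)
  next
    case all_odd: False
    show ?thesis
    proof (cases "\<exists>w\<in>S. card (orbit p w) \<ge> 5")
      case True
      then obtain w where w: "w \<in> S" "card (orbit p w) \<ge> 5" "odd (card (orbit p w))"
        using all_odd by blast
      obtain q where q: "alt_commuting_conj S p q" "q (q w) = (p ^^ 8) w"
        using alt_commuting_conj_fourth_power[OF S(1) p w(1,3)] by metis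
      have "q (q w) \<noteq> p (p w)"
      proof
        assume "q (q w) = p (p w)"
        then have "(p ^^ 8) w = (p ^^ 2) w" using q by (simp add: numeral_2_eq_2)
        then have "[8 = 2] (mod card (orbit p w))" by (simp only: funpow_eq_iff_cong[OF pp])
        \<comment> \<open>The exponents 8 and 2 differ by 6, whose odd divisors are only 1 and
          3.\<close>
        then have "card (orbit p w) dvd 6" by (simp add: cong_altdef_nat)
        then have "card (orbit p w) \<le> 6" "card (orbit p w) dvd 6" by (auto dest: dvd_imp_le)
        moreover have "card (orbit p w) = 5 \<or> card (orbit p w) = 6" using calculation w(2) by linarith
        ultimately show False using w(3) by auto
      qed
      then show ?thesis using that[OF q(1)] by (metis comp_apply)
    next
      case False
      have card: "card (orbit p w) = 1 \<or> card (orbit p w) = 3" if "w \<in> S" for w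
      proof -
        have "card (orbit p w) < 5" "odd (card (orbit p w))" using False all_odd that by auto
        moreover from this(1) have "card (orbit p w) \<in> {0, 1, 2, 3, 4}" by auto
        ultimately show ?thesis by auto
      qed
      have "p (p (p w)) = w" for w
      proof (cases "w \<in> S")
        case True
        then have "(p ^^ 3) w = w" using card[OF True] pp by (intro funpow_card_orbit_multiple) auto
        then show ?thesis by (simp add: numeral_3_eq_3)
      qed (simp add: permutes_not_in[OF p])
      moreover have "p x \<noteq> x" using x orbit_eq_singleton_iff[of p x] by auto
      ultimately show ?thesis
        using alt_commuting_conj_order_3[OF S p] that by (metis comp_apply)
    qed
  qed
qed

text \<open>Only cycle lengths 1, 2 and 4 are left to treat. A 4-cycle differs from its inverse, and
  it supplies the odd element of the centralizer itself; without 4-cycles \<open>p\<close> is an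
  involution.\<close>

lemma alt_commuting_conj_neq:
  assumes S: "finite S" "5 \<le> card S" and p: "p permutes S" "p \<noteq> id"
  obtains q where "alt_commuting_conj S p q" "q \<noteq> p"
proof (cases "\<exists>x\<in>S. card (orbit p x) \<notin> {1, 2, 4}")
  case True
  then show thesis using alt_commuting_conj_square_neq[OF S p(1)] that by metis
next
  case small: False
  have pp: "permutation p" using S p by (auto simp: permutation_permutes)
  show thesis
  proof (cases "\<exists>x\<in>S. card (orbit p x) = 4")
    case True
    then obtain x where x: "x \<in> S" "card (orbit p x) = 4" by blast
    then obtain c where c: "c permutes S" "\<not> evenperm c" "c \<circ> p = p \<circ> c"
      using exists_odd_commuting[OF p(1) S(1) x(1)] by auto
    obtain q where q: "alt_commuting_conj S p q" "q x = (p ^^ 3) x"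
      using alt_commuting_conj_inverse_on_orbit[OF S(1) p(1) c x(1)] x(2) by auto
    have "(p ^^ 3) x \<noteq> (p ^^ 1) x"
      unfolding funpow_eq_iff_cong[OF pp] x(2) by (simp add: cong_def)
    then have "q x \<noteq> p x" using q by simp
    then show ?thesis using that[OF q(1)] by metis
  next
    case False
    have "p (p w) = w" for w
    proof (cases "w \<in> S")
      case True
      then have "(p ^^ 2) w = w" using small False pp by (intro funpow_card_orbit_multiple) auto
      then show ?thesis by (simp add: numeral_2_eq_2)
    qed (simp add: permutes_not_in[OF p(1)])
    moreover obtain x where "p x \<noteq> x" using p(2) by (auto simp: fun_eq_iff)
    ultimately show ?thesis using alt_commuting_conj_involution[OF S p(1)] that by blast
  qed
qed


section \<open>Type D criteria for alternating groups\<close>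

lemma sym_group_alt_carrier: "sym_group n\<lparr>carrier := carrier (alt_group n)\<rparr> = alt_group n"
  by (simp add: alt_group_def)

lemma conj_twist_alt_group:
  assumes \<tau>: "\<tau> permutes {1..n}" and t: "2 \<le> t"
  shows "conj_twist (sym_group n) (carrier (alt_group n)) \<tau> (alt_conj n \<tau>) t"
proof -
  interpret group "sym_group n" by (rule sym_group_is_group)
  have "carrier (alt_group n) \<lhd> sym_group n"
    unfolding alt_group_is_sign_kernel using sign_group_hom by (rule group_hom.normal_kernel)
  moreover have "alt_conj n \<tau> \<in> auto (sym_group n\<lparr>carrier := carrier (alt_group n)\<rparr>)"
    unfolding sym_group_alt_carrier using \<tau> by (rule alt_conj_in_auto)
  moreover have "\<tau> \<in> carrier (sym_group n)" using \<tau> by (simp add: sym_group_carrier)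
  ultimately show ?thesis
    using t is_group by (intro conj_twist.intro conj_twist_axioms.intro) (auto simp: alt_conj_def sym_group_mult)
qed

lemma alt_conj_id: "alt_conj n id = (\<lambda>g\<in>carrier (alt_group n). g)"
  by (auto simp: alt_conj_def fun_eq_iff)

abbreviation alt_twisted_type_D :: "nat \<Rightarrow> nat \<Rightarrow> (nat \<Rightarrow> nat) \<Rightarrow> (nat \<Rightarrow> nat) \<Rightarrow> bool" where
  "alt_twisted_type_D n t \<tau> l \<equiv>
    type_D (twisted_op (alt_group n) t (alt_conj n \<tau>)) (twisted_rack (alt_group n) t (alt_conj n \<tau>) l)"

lemma alt_twisted_type_D_commuting:
  assumes \<tau>: "\<tau> permutes {1..n}" and t: "2 \<le> t" and l: "l \<in> carrier (alt_group n)"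
    and q: "alt_commuting_conj {1..n} (l \<circ> \<tau>) q" "q \<noteq> l \<circ> \<tau>"
      "t = 2 \<Longrightarrow> q \<circ> q \<noteq> (l \<circ> \<tau>) \<circ> (l \<circ> \<tau>)"
  shows "alt_twisted_type_D n t \<tau> l"
proof -
  interpret conj_twist "sym_group n" "carrier (alt_group n)" \<tau> "alt_conj n \<tau>" t
    using \<tau> t by (rule conj_twist_alt_group)
  obtain u where u: "u permutes {1..n}" "evenperm u" "q = u \<circ> (l \<circ> \<tau>) \<circ> inv' u"
    using q(1) by (auto simp: alt_commuting_conj_def)
  have uc: "u \<in> carrier (alt_group n)" "u \<in> carrier (sym_group n)"
    using u by (simp_all add: alt_group_carrier sym_group_carrier)
  have "type_D (twisted_op (sym_group n\<lparr>carrier := carrier (alt_group n)\<rparr>) t (alt_conj n \<tau>))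
      (twisted_rack (sym_group n\<lparr>carrier := carrier (alt_group n)\<rparr>) t (alt_conj n \<tau>) l)"
    using l uc(1)
  proof (rule type_D_commuting_conjugate)
    show "q = u \<otimes>\<^bsub>sym_group n\<^esub> (l \<circ> \<tau>) \<otimes>\<^bsub>sym_group n\<^esub> inv\<^bsub>sym_group n\<^esub> u"
      using u uc by (simp add: sym_group_mult)
  qed (use q in \<open>auto simp: sym_group_mult alt_commuting_conj_def\<close>)
  then show ?thesis unfolding sym_group_alt_carrier .
qed

section \<open>The sign on an invariant set as a character\<close>

lemma subgroup_setwise_stabilizer: "subgroup {h. h permutes {1..n} \<and> h ` B = B} (sym_group n)"
proof -
  interpret group "sym_group n" by (rule sym_group_is_group)
  show ?thesis
  proof (rule subgroupI)
    show "inv\<^bsub>sym_group n\<^esub> h \<in> {h. h permutes {1..n} \<and> h ` B = B}"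
      if "h \<in> {h. h permutes {1..n} \<and> h ` B = B}" for h
    proof -
      have h: "h permutes {1..n}" "h ` B = B" using that by auto
      have "inv' h ` B = inv' h ` (h ` B)" using h by simp
      also have "\<dots> = B" using permutes_inverses(2)[OF h(1)] by (simp add: image_image)
      finally show ?thesis using h permutes_inv[OF h(1)] by (simp add: sym_group_carrier)
    qed
    show "g \<otimes>\<^bsub>sym_group n\<^esub> h \<in> {h. h permutes {1..n} \<and> h ` B = B}"
      if "g \<in> {h. h permutes {1..n} \<and> h ` B = B}" "h \<in> {h. h permutes {1..n} \<and> h ` B = B}" for g h
      using that image_comp[of g h B] by (simp add: sym_group_mult permutes_compose)
  qed (auto simp: sym_group_carrier intro!: exI[of _ id])
qed

lemma sign_on_comp_stabilizer:
  assumes "finite B" "g permutes A" "h permutes A" "g ` B = B" "h ` B = B"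
  shows "sign_on B (g \<circ> h) = sign_on B g * sign_on B h"
  using assms by (intro sign_on_compose) (auto simp: bij_betw_def permutes_inj_on)

text \<open>The sign written additively: modulo 2 it is a character on the stabilizer of
  \<open>B\<close>, in the form that \<open>type_D_character\<close> takes.\<close>

definition parity_on :: "'a set \<Rightarrow> ('a \<Rightarrow> 'a) \<Rightarrow> int" where
  "parity_on B h = (if sign_on B h = 1 then 0 else 1)"

lemma sign_on_cases: "sign_on B h = 1 \<or> sign_on B h = -1"
  by (simp add: sign_on_def sign_def)

lemma parity_on_mult:
  assumes "finite B" "g permutes A" "h permutes A" "g ` B = B" "h ` B = B"
  shows "[parity_on B (g \<circ> h) = parity_on B g + parity_on B h] (mod 2)"
  using sign_on_comp_stabilizer[OF assms] sign_on_cases[of B g] sign_on_cases[of B h]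
  by (auto simp: parity_on_def cong_def)

text \<open>The tuples \<open>(f, \<sigma> \<circ> inv' f)\<close> have product
  \<open>\<sigma>\<close>, so their parities on \<open>B\<close> have the same sum. Modulo 2 the
  weighted sum is the parity of the first entry \<open>f\<close>, by which \<open>g\<close> and
  \<open>h\<close> are distinguished.\<close>

lemma alt_twisted_type_D_parity_2:
  assumes \<tau>: "\<tau> permutes {1..n}" and l: "l \<in> carrier (alt_group n)" and \<sigma>: "\<sigma> = l \<circ> \<tau>"
    and B: "finite B" "\<sigma> ` B = B"
    and g: "g permutes {1..n}" "g ` B = B" "evenperm g = evenperm \<sigma>"
    and h: "h permutes {1..n}" "h ` B = B" "evenperm h = evenperm \<sigma>"
    and sgn: "sign_on B g \<noteq> sign_on B h"
    and sq: "(g \<circ> \<sigma> \<circ> inv' h) \<circ> (g \<circ> \<sigma> \<circ> inv' h) \<noteq> (h \<circ> \<sigma> \<circ> inv' g) \<circ> (h \<circ> \<sigma> \<circ> inv' g)"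
  shows "alt_twisted_type_D n 2 \<tau> l"
proof -
  interpret conj_twist "sym_group n" "carrier (alt_group n)" \<tau> "alt_conj n \<tau>" 2
    using \<tau> by (rule conj_twist_alt_group) simp
  let ?H = "{h. h permutes {1..n} \<and> h ` B = B}"
  have lp: "l permutes {1..n}" "evenperm l" using l by (auto simp: alt_group_carrier)
  have \<sigma>p: "\<sigma> permutes {1..n}" using lp \<tau> by (auto simp: \<sigma> permutes_compose)
  have perm: "permutation f" if "f permutes {1..n}" for f using that by (auto intro: permutes_imp_permutation)
  have ev\<sigma>: "evenperm \<sigma> = evenperm \<tau>" using lp \<tau> perm by (simp add: \<sigma> evenperm_comp)
  define X where "X f i = (if i = 1 then f else \<sigma> \<circ> inv' f)" for f and i :: nat
  have H: "subgroup ?H (sym_group n)" by (rule subgroup_setwise_stabilizer)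
  have XH: "X f i \<in> ?H" if "f \<in> ?H" for f i
  proof -
    have "inv' f \<in> ?H" using subgroup.m_inv_closed[OF H that] that by (simp add: sym_group_carrier)
    then show ?thesis using that B \<sigma>p image_comp[of \<sigma> "inv' f" B] by (simp add: X_def permutes_compose)
  qed
  have adm: "admissible l (X f)" if f: "f permutes {1..n}" "evenperm f = evenperm \<sigma>" for f
  proof -
    have i: "inv' f permutes {1..n}" "inv' \<tau> permutes {1..n}" using f \<tau> by (auto intro: permutes_inv)
    have "\<sigma> \<circ> inv' f \<in> carrier (alt_group n)"
      using f i \<sigma>p perm by (auto simp: alt_group_carrier permutes_compose evenperm_comp evenperm_inv)
    moreover have "f \<circ> inv' \<tau> \<in> carrier (alt_group n)"
      using f i \<tau> perm ev\<sigma> by (auto simp: alt_group_carrier permutes_compose evenperm_comp evenperm_inv)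
    moreover have "rprod (X f) 2 = \<sigma>"
      using permutes_inv_o(2)[OF f(1)] by (simp add: X_def numeral_2_eq_2 sym_group_mult sym_group_one comp_assoc)
    moreover have "id \<in> carrier (alt_group n)" by (simp add: alt_group_carrier)
    ultimately show ?thesis
      unfolding admissible_def using f \<tau>
      by (auto simp: X_def sym_group_mult sym_group_carrier \<sigma> comp_assoc intro!: bexI[of _ id])
  qed
  have "type_D (twisted_op (sym_group n\<lparr>carrier := carrier (alt_group n)\<rparr>) 2 (alt_conj n \<tau>))
      (twisted_rack (sym_group n\<lparr>carrier := carrier (alt_group n)\<rparr>) 2 (alt_conj n \<tau>) l)"
  proof (rule type_D_character[OF l H, where m = 2 and \<chi> = "parity_on B" and r = "X g" and s = "X h" and i = 1])
    show "[parity_on B (a \<otimes>\<^bsub>sym_group n\<^esub> b) = parity_on B a + parity_on B b] (mod 2)"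
      if "a \<in> ?H" "b \<in> ?H" for a b
      using that B by (auto simp: sym_group_mult intro!: parity_on_mult)
    have "[parity_on B (X f 1) + parity_on B (X f 2) = parity_on B \<sigma>] (mod 2)" if f: "f \<in> ?H" for f
    proof -
      have "[parity_on B (X f 2 \<circ> X f 1) = parity_on B (X f 2) + parity_on B (X f 1)] (mod 2)"
        using XH[OF f, of 1] XH[OF f, of 2] B by (intro parity_on_mult) auto
      moreover have "X f 2 \<circ> X f 1 = \<sigma>" using f permutes_inv_o(2)[of f] by (auto simp: X_def comp_assoc)
      ultimately show ?thesis by (simp add: cong_sym_eq add.commute)
    qed
    from this[of g] this[of h]
    show "[(\<Sum>i=1..2. parity_on B (X g i)) = (\<Sum>i=1..2. parity_on B (X h i))] (mod 2)"
      using g h by (simp add: numeral_2_eq_2 cong_def)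
    show "\<not> [(\<Sum>i=1..2. int i * parity_on B (X g i)) = (\<Sum>i=1..2. int i * parity_on B (X h i))] (mod 2)"
      using sgn sign_on_cases[of B g] sign_on_cases[of B h]
      by (auto simp: numeral_2_eq_2 X_def cong_iff_dvd_diff parity_on_def)
    have p: "prev 1 = 2" "prev 2 = 1" by (simp_all add: prev_def)
    show "X g 1 \<otimes>\<^bsub>sym_group n\<^esub> X h (prev 1) \<otimes>\<^bsub>sym_group n\<^esub> X g (prev (prev 1)) \<otimes>\<^bsub>sym_group n\<^esub>
        X h (prev (prev (prev 1))) \<noteq>
      X h 1 \<otimes>\<^bsub>sym_group n\<^esub> X g (prev 1) \<otimes>\<^bsub>sym_group n\<^esub> X h (prev (prev 1)) \<otimes>\<^bsub>sym_group n\<^esub>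
        X g (prev (prev (prev 1)))"
      unfolding p using sq by (simp add: X_def sym_group_mult comp_assoc)
  qed (use XH g h adm in auto)
  then show ?thesis unfolding sym_group_alt_carrier .
qed

lemma three_cycle:
  assumes "a \<noteq> b" "b \<noteq> d" "a \<noteq> d"
  defines "c \<equiv> transpose a b \<circ> transpose b d"
  shows "c a = b" "c b = d" "c d = a" "w \<notin> {a, b, d} \<Longrightarrow> c w = w" "c (c (c w)) = w"
    "permutation c" "evenperm c" "{a, b, d} \<subseteq> S \<Longrightarrow> c permutes S"
  using assms
  by (auto simp: transpose_def permutation_compose permutation_swap_id evenperm_comp evenperm_swap
      permutes_compose permutes_swap_id)

lemma sign_on_outside: "(\<And>x. x \<in> B \<Longrightarrow> f x = x) \<Longrightarrow> sign_on B f = 1"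
  using sign_on_cong[of B B f id] by simp

lemma sign_on_orbit:
  "permutation p \<Longrightarrow> sign_on (orbit p x) p = (if even (card (orbit p x)) then -1 else 1)"
  by (simp add: sign_on_def sign_def evenperm_restrict_orbit)

lemma image_orbit: "permutation p \<Longrightarrow> p ` orbit p x = orbit p x"
  by (rule bij_betw_imp_surj_on[OF bij_betw_orbit])

text \<open>The left side of \<open>eq\<close> equals \<open>l \<circ> c \<circ> inv' l\<close>,
  since \<open>c\<close> has trivial cube. Cancelling shows that \<open>c\<close> must be the
  inverse of the fourth power of \<open>l\<close>, so at most one \<open>c\<close> can satisfy
  \<open>eq\<close>.\<close>

lemma three_cycle_square_eqD:
  assumes l: "bij l" and c: "bij c" "\<And>w. c (c (c w)) = w"
    and eq: "(l \<circ> inv' (l \<circ> c)) \<circ> (l \<circ> inv' (l \<circ> c)) = (l \<circ> c \<circ> l) \<circ> (l \<circ> c \<circ> l)"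
  shows "l (l (c (l (l w)))) = w"
proof -
  have inj: "inj l" "inj c" "inj (l \<circ> c)" using l c by (auto simp: bij_is_inj bij_comp)
  have F: "(l \<circ> inv' (l \<circ> c)) (l v) = l (c (c v))" for v
    using inv_f_f[OF inj(3), of "c (c v)"] c(2) by simp
  have "l (c w) = l (c (l (l (c (l (l w))))))"
    using fun_cong[OF eq, of "l w"] F c(2) by simp
  then show ?thesis using inj by (simp add: inj_eq)
qed

text \<open>The identity is compared with \<open>l \<circ> c\<close> for a 3-cycle \<open>c\<close>
  that has sign 1 on the even orbit, where \<open>l\<close> has sign -1. Both first entries are even
  permutations.\<close>

lemma alt_twisted_type_D_even_orbit:
  assumes n: "5 \<le> n" and l: "l \<in> carrier (alt_group n)" and x: "x \<in> {1..n}" "even (card (orbit l x))"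
  shows "alt_twisted_type_D n 2 id l"
proof -
  let ?B = "orbit l x"
  have lp: "l permutes {1..n}" "evenperm l" "permutation l"
    using l by (auto simp: alt_group_carrier intro: permutes_imp_permutation)
  have sub: "?B \<subseteq> {1..n}" using lp x by (simp add: permutes_orbit_subset)
  have fin: "finite ?B" using lp(3) by (rule finite_orbit_permutation)
  have "card ({1..n} - ?B) = n - card ?B" using card_Diff_subset[OF fin sub] by simp
  \<comment> \<open>With at least five points, the orbit or its complement has room for a 3-cycle;
    in both cases the 3-cycle preserves the orbit.\<close>
  then have "3 \<le> card ?B \<or> 3 \<le> card ({1..n} - ?B)" using n by linarith
  then obtain T where T: "T = ?B \<or> T = {1..n} - ?B" "3 \<le> card T" by blast
  obtain U where "U \<subseteq> T" "card U = 3" using obtain_subset_with_card_n[OF T(2)] by metis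
  then obtain a b d where abd: "{a, b, d} \<subseteq> T" "a \<noteq> b" "b \<noteq> d" "a \<noteq> d"
    by (auto simp: card_3_iff)
  have key: "alt_twisted_type_D n 2 id l"
    if c: "c = transpose a b \<circ> transpose b d" and abd: "{a, b, d} \<subseteq> T" "a \<noteq> b" "b \<noteq> d" "a \<noteq> d"
      and neq: "\<exists>w. l (l (c (l (l w)))) \<noteq> w" for a b c d
  proof -
    note c3 = three_cycle[OF abd(2-4), folded c]
    have cn: "c permutes {1..n}" using abd T sub by (intro c3(8)) auto
    have cB: "c ` ?B = ?B" "sign_on ?B c = 1"
    proof -
      have "c ` ?B = ?B \<and> sign_on ?B c = 1"
      proof (cases "T = ?B")
        case True
        then have "c permutes ?B" using abd by (intro c3(8)) auto
        then show ?thesis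
          using c3(7) by (auto simp: permutes_image sign_on_permutes sign_def)
      next
        case False
        then have "c w = w" if "w \<in> ?B" for w using that T abd by (intro c3(4)) auto
        then show ?thesis by (auto simp: sign_on_outside)
      qed
      then show "c ` ?B = ?B" "sign_on ?B c = 1" by auto
    qed
    have lB: "l ` ?B = ?B" using lp(3) by (rule image_orbit)
    have "sign_on ?B (l \<circ> c) = -1"
      using sign_on_comp_stabilizer[OF fin lp(1) cn lB cB(1)] cB(2) sign_on_orbit[OF lp(3), of x] x(2)
      by simp
    moreover have "(l \<circ> inv' (l \<circ> c)) \<circ> (l \<circ> inv' (l \<circ> c)) \<noteq> (l \<circ> c \<circ> l) \<circ> (l \<circ> c \<circ> l)"
      using three_cycle_square_eqD[OF permutes_bij[OF lp(1)] permutes_bij[OF cn] c3(5)] neq by blast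
    ultimately show ?thesis
      using lp c3(6,7) cn fin lB cB image_comp[of l c ?B]
      by (intro alt_twisted_type_D_parity_2[where \<sigma> = l and B = ?B and g = id and h = "l \<circ> c"])
        (simp_all add: l permutes_id permutes_compose evenperm_comp comp_assoc)
  qed
  \<comment> \<open>The second permutation is the inverse 3-cycle. Since the fourth power of
    \<open>l\<close> determines the exceptional \<open>c\<close>, the two orientations cannot both
    be exceptional.\<close>
  have "\<exists>w. l (l ((transpose a b \<circ> transpose b d) (l (l w)))) \<noteq> w \<or>
      l (l ((transpose d b \<circ> transpose b a) (l (l w)))) \<noteq> w"
  proof (rule ccontr)
    assume "\<nexists>w. l (l ((transpose a b \<circ> transpose b d) (l (l w)))) \<noteq> w \<or>
      l (l ((transpose d b \<circ> transpose b a) (l (l w)))) \<noteq> w"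
    then have "l (l ((transpose a b \<circ> transpose b d) (l (l w)))) =
        l (l ((transpose d b \<circ> transpose b a) (l (l w))))" for w by metis
    then have "(transpose a b \<circ> transpose b d) (l (l w)) = (transpose d b \<circ> transpose b a) (l (l w))" for w
      using permutes_inj[OF lp(1)] by (metis inj_eq)
    then have "(transpose a b \<circ> transpose b d) a = (transpose d b \<circ> transpose b a) a"
      using permutes_inverses(1)[OF lp(1)] by metis
    then show False using abd by (auto simp: transpose_def split: if_splits)
  qed
  then show ?thesis
    using key[OF refl, of a b d] key[OF refl, of d b a] abd by blast
qed

text \<open>The first entries are \<open>\<sigma>\<close> and \<open>h\<close>, a 3-cycle on the
  4-cycle times the transposition of \<open>a\<close> and \<open>b\<close>. Both are odd, but their
  signs on the 4-cycle differ, because the transposition acts outside it.\<close>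

lemma alt_twisted_type_D_four_orbit:
  assumes \<tau>: "\<tau> permutes {1..n}" "\<not> evenperm \<tau>" and l: "l \<in> carrier (alt_group n)"
    and x: "x \<in> {1..n}" "card (orbit (l \<circ> \<tau>) x) = 4"
    and ab: "{a, b} \<subseteq> {1..n} - orbit (l \<circ> \<tau>) x" "a \<noteq> b"
  shows "alt_twisted_type_D n 2 \<tau> l"
proof -
  define \<sigma> where "\<sigma> = l \<circ> \<tau>"
  let ?B = "orbit \<sigma> x"
  have lp: "l permutes {1..n}" "evenperm l" "permutation l"
    using l by (auto simp: alt_group_carrier intro: permutes_imp_permutation)
  have \<sigma>p: "\<sigma> permutes {1..n}" using lp \<tau> by (simp add: \<sigma>_def permutes_compose)
  have ps: "permutation \<sigma>" "permutation \<tau>" using \<sigma>p \<tau> by (auto intro: permutes_imp_permutation)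
  have \<sigma>odd: "\<not> evenperm \<sigma>" using lp \<tau> ps by (simp add: \<sigma>_def evenperm_comp)
  have card: "card ?B = 4" using x by (simp add: \<sigma>_def)
  have fin: "finite ?B" using ps(1) by (rule finite_orbit_permutation)
  have sub: "?B \<subseteq> {1..n}" using \<sigma>p x by (simp add: permutes_orbit_subset)
  define y z where "y = \<sigma> x" and "z = \<sigma> (\<sigma> x)"
  have "(\<sigma> ^^ 0) x \<noteq> (\<sigma> ^^ 1) x" "(\<sigma> ^^ 1) x \<noteq> (\<sigma> ^^ 2) x" "(\<sigma> ^^ 0) x \<noteq> (\<sigma> ^^ 2) x"
      "(\<sigma> ^^ 4) x = (\<sigma> ^^ 0) x"
    unfolding funpow_eq_iff_cong[OF ps(1)] card by (simp_all add: cong_def)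
  then have d: "x \<noteq> y" "y \<noteq> z" "x \<noteq> z" "\<sigma> (\<sigma> z) = x"
    by (simp_all add: y_def z_def numeral_eq_Suc)
  define c where "c = transpose x y \<circ> transpose y z"
  note c3 = three_cycle[OF d(1-3), folded c_def]
  have xyz: "{x, y, z} \<subseteq> ?B"
    using permutation_self_in_orbit[OF ps(1), of x] by (auto simp: y_def z_def intro: orbit.intros)
  have cB: "c permutes ?B" using xyz by (intro c3(8))
  have cn: "c permutes {1..n}" using cB sub by (rule permutes_subset)
  define h where "h = c \<circ> transpose a b"
  have hB: "h w = c w" if "w \<in> ?B" for w
    using that ab by (auto simp: h_def \<sigma>_def transpose_def)
  have hn: "h permutes {1..n}" using ab cn by (auto simp: h_def permutes_compose permutes_swap_id)
  have hodd: "\<not> evenperm h" using ab c3 by (simp add: h_def evenperm_comp permutation_swap_id evenperm_swap)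
  have himg: "h ` ?B = ?B" using hB permutes_image[OF cB] by (metis image_cong)
  have "sign_on ?B h = sign_on ?B c" using hB by (intro sign_on_cong) auto
  also have "\<dots> = 1" using cB c3(7) by (simp add: sign_on_permutes sign_def)
  finally have "sign_on ?B \<sigma> \<noteq> sign_on ?B h" using sign_on_orbit[OF ps(1), of x] card by simp
  \<comment> \<open>At \<open>x\<close> the left side returns \<open>x\<close>, because
    \<open>inv' h\<close> sends \<open>x\<close> to \<open>z\<close> and
    \<open>\<sigma> \<circ> \<sigma>\<close> sends \<open>z\<close> back; the right side is the
    square of \<open>h\<close> and gives \<open>z\<close>.\<close>
  moreover have "(\<sigma> \<circ> \<sigma> \<circ> inv' h) \<circ> (\<sigma> \<circ> \<sigma> \<circ> inv' h) \<noteq> (h \<circ> \<sigma> \<circ> inv' \<sigma>) \<circ> (h \<circ> \<sigma> \<circ> inv' \<sigma>)"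
  proof
    assume eq: "(\<sigma> \<circ> \<sigma> \<circ> inv' h) \<circ> (\<sigma> \<circ> \<sigma> \<circ> inv' h) = (h \<circ> \<sigma> \<circ> inv' \<sigma>) \<circ> (h \<circ> \<sigma> \<circ> inv' \<sigma>)"
    have hv: "h x = y" "h y = z" "h z = x" using hB c3 xyz by auto
    then have "inv' h x = z" using permutes_inverses(2)[OF hn] by metis
    then have "((\<sigma> \<circ> \<sigma> \<circ> inv' h) \<circ> (\<sigma> \<circ> \<sigma> \<circ> inv' h)) x = x" using d by simp
    moreover have "((h \<circ> \<sigma> \<circ> inv' \<sigma>) \<circ> (h \<circ> \<sigma> \<circ> inv' \<sigma>)) x = z"
      using hv permutes_inverses(1)[OF \<sigma>p] by simp
    ultimately show False using eq d by simp
  qed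
  ultimately show ?thesis
    using hn hodd himg \<sigma>p \<sigma>odd fin image_orbit[OF ps(1)] \<tau> l
    by (intro alt_twisted_type_D_parity_2[where \<sigma> = \<sigma> and B = ?B and g = \<sigma> and h = h])
      (simp_all add: \<sigma>_def)
qed

text \<open>Each factor of \<open>h = (1 2 3)(4 5)(6 7)\<close> has a task: \<open>(4 5)\<close>
  gives sign -1 on \<open>{4, 5}\<close>, \<open>(6 7)\<close> makes \<open>h\<close> even, and the
  3-cycle makes the fourth power of \<open>h\<close> nontrivial. This takes seven points.\<close>

lemma alt_twisted_type_D_identity_2:
  assumes n: "7 \<le> n"
  shows "alt_twisted_type_D n 2 id id"
proof -
  define h :: "nat \<Rightarrow> nat" where
    "h = transpose 1 2 \<circ> transpose 2 3 \<circ> transpose 4 5 \<circ> transpose 6 7"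
  have hn: "h permutes {1..n}" unfolding h_def using n
    by (intro permutes_compose permutes_swap_id) auto
  have even: "evenperm h"
    by (simp add: h_def evenperm_comp permutation_swap_id permutation_compose evenperm_swap)
  have himg: "h ` {4, 5} = {4, 5}" by (auto simp: h_def transpose_def)
  have "sign_on {4, 5} h = sign_on {4, 5} (transpose (4 :: nat) 5)"
    by (intro sign_on_cong) (auto simp: h_def transpose_def)
  also have "\<dots> = -1" by (rule sign_on_transpose) auto
  finally have "sign_on {4, 5} id \<noteq> sign_on {4, 5} h" by simp
  moreover have "inv' h \<circ> inv' h \<noteq> h \<circ> h"
  proof
    assume eq: "inv' h \<circ> inv' h = h \<circ> h"
    have "h 1 = 2" "h 2 = 3" "h 3 = 1" by (simp_all add: h_def transpose_def)
    then have "inv' h 1 = 3" "inv' h 3 = 2" using permutes_inverses(2)[OF hn] by metis+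
    then have "(inv' h \<circ> inv' h) 1 = 2" by simp
    moreover have "(h \<circ> h) 1 = 3" using \<open>h 1 = 2\<close> \<open>h 2 = 3\<close> by simp
    ultimately show False using eq by simp
  qed
  ultimately show ?thesis
    using hn even himg
    by (intro alt_twisted_type_D_parity_2[where \<sigma> = id and B = "{4, 5}" and g = id and h = h])
      (simp_all add: alt_group_carrier)
qed

text \<open>The constant tuple \<open>id\<close> is compared with \<open>s\<close>, which has
  product \<open>id\<close> because \<open>b\<close> has order 3 and \<open>c\<close> order 2. On
  \<open>{4, 5}\<close> exactly the entries 3 and 4 are odd: their number is even, but the sum of
  their indices is odd. The inequality at index 4 says that \<open>b\<close> and \<open>c\<close> do
  not commute.\<close>

lemma alt_twisted_type_D_identity_even:
  assumes n: "5 \<le> n" and t4: "4 \<le> t" "even t"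
  shows "alt_twisted_type_D n t id id"
proof -
  interpret conj_twist "sym_group n" "carrier (alt_group n)" id "alt_conj n id" t
    using t4 by (intro conj_twist_alt_group) auto
  let ?H = "{h. h permutes {1..n} \<and> h ` {4, 5} = {4, 5}}"
  define b c :: "nat \<Rightarrow> nat" where "b = transpose 1 2 \<circ> transpose 2 3" and "c = transpose 1 2 \<circ> transpose 4 5"
  define r s :: "nat \<Rightarrow> nat \<Rightarrow> nat" where "r = (\<lambda>_. id)"
    and "s = (\<lambda>i. if i = 2 then b else if i = 3 then c else if i = 4 then b \<circ> b \<circ> c else id)"
  have perms: "b permutes {1..n}" "c permutes {1..n}"
    unfolding b_def c_def using n by (auto intro!: permutes_compose permutes_swap_id)
  have pp: "permutation b" "permutation c" using perms by (auto intro: permutes_imp_permutation)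
  have ev: "evenperm b" "evenperm c"
    by (auto simp: b_def c_def evenperm_comp permutation_swap_id evenperm_swap)
  have img: "b ` {4, 5} = {4, 5}" "c ` {4, 5} = {4, 5}"
    by (auto simp: b_def c_def transpose_def)
  have sA: "s i \<in> carrier (alt_group n)" for i
    using perms pp ev by (auto simp: s_def alt_group_carrier permutes_compose evenperm_comp permutation_compose)
  have sH: "s i \<in> ?H" for i
  proof -
    have "(b \<circ> b \<circ> c) ` {4, 5} = {4, 5}" using img by (metis image_comp)
    then show ?thesis using perms img by (simp add: s_def permutes_compose)
  qed
  have bcb: "b \<circ> b \<circ> c \<circ> (c \<circ> b) = id"
  proof
    fix w
    have "b (b (b w)) = w" unfolding b_def by (rule three_cycle(5)) auto
    moreover have "c (c v) = v" for v by (simp add: c_def transpose_def)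
    ultimately show "(b \<circ> b \<circ> c \<circ> (c \<circ> b)) w = id w" by simp
  qed
  have rp: "rprod s (4 + k) = id" for k
  proof (induction k)
    case 0
    then show ?case using bcb by (simp add: s_def numeral_eq_Suc sym_group_mult sym_group_one comp_assoc)
  next
    case (Suc k)
    moreover have "rprod s (4 + Suc k) = s (Suc (4 + k)) \<otimes>\<^bsub>sym_group n\<^esub> rprod s (4 + k)"
      by (simp only: add_Suc_right rprod.simps)
    moreover have "s (Suc (4 + k)) = id" by (simp add: s_def)
    ultimately show ?case by (simp add: sym_group_mult)
  qed
  have "4 + (t - 4) = t" using t4 by simp
  with rp[of "t - 4"] have rs: "rprod s t = id" by metis
  have rr: "rprod r k = id" for k by (induction k) (simp_all add: r_def sym_group_mult sym_group_one)
  have idA: "id \<in> carrier (alt_group n)" by (simp add: alt_group_carrier)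
  have idi: "inv\<^bsub>sym_group n\<^esub> id = id" using inv_one by (simp add: sym_group_one)
  have adm: "admissible id X" if "rprod X t = id" "\<And>i. X i \<in> carrier (alt_group n)" for X
    using that idA idi unfolding admissible_def
    by (auto simp: sym_group_mult sym_group_carrier alt_group_carrier intro!: bexI[of _ id])
  have sgn: "sign_on {4, 5} b = 1" "sign_on {4, 5} c = -1" "sign_on {4, 5} (b \<circ> b \<circ> c) = -1"
  proof -
    show b: "sign_on {4, 5} b = 1" by (rule sign_on_outside) (auto simp: b_def transpose_def)
    have "sign_on {4, 5} c = sign_on {4, 5} (transpose (4 :: nat) 5)"
      by (intro sign_on_cong) (auto simp: c_def transpose_def)
    also have "\<dots> = -1" by (rule sign_on_transpose) auto
    finally show "sign_on {4, 5} c = -1" .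
    moreover have "sign_on {4, 5} (b \<circ> b \<circ> c) = sign_on {4, 5} c"
      by (intro sign_on_cong) (auto simp: b_def c_def transpose_def)
    ultimately show "sign_on {4, 5} (b \<circ> b \<circ> c) = -1" by simp
  qed
  have par: "parity_on {4, 5} (s i) = (if i \<in> {3, 4} then 1 else 0)" for i
  proof -
    have "parity_on {4, 5} b = 0" "parity_on {4, 5} c = 1" "parity_on {4, 5} (b \<circ> b \<circ> c) = 1"
      unfolding parity_on_def sgn by simp_all
    moreover have "parity_on {4, 5 :: nat} id = 0" by (simp add: parity_on_def)
    ultimately show ?thesis by (simp add: s_def)
  qed
  have supp: "(\<Sum>i=1..t. f i * parity_on {4, 5} (s i)) = f 3 + f 4" for f :: "nat \<Rightarrow> int"
  proof -
    have "(\<Sum>i=1..t. f i * parity_on {4, 5} (s i)) = (\<Sum>i\<in>{3, 4}. f i * parity_on {4, 5} (s i))"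
      using t4 by (intro sum.mono_neutral_right) (auto simp: par)
    then show ?thesis by (simp add: par)
  qed
  have "type_D (twisted_op (sym_group n\<lparr>carrier := carrier (alt_group n)\<rparr>) t (alt_conj n id))
      (twisted_rack (sym_group n\<lparr>carrier := carrier (alt_group n)\<rparr>) t (alt_conj n id) id)"
  proof (rule type_D_character[OF idA subgroup_setwise_stabilizer[of n "{4, 5}"], where m = 2
      and \<chi> = "parity_on {4, 5}" and r = r and s = s and i = 4])
    show "[parity_on {4, 5} (g \<otimes>\<^bsub>sym_group n\<^esub> h) = parity_on {4, 5} g + parity_on {4, 5} h] (mod 2)"
      if "g \<in> ?H" "h \<in> ?H" for g h
      using that by (auto simp: sym_group_mult intro!: parity_on_mult)
    show "admissible id r" using rr idA by (intro adm) (auto simp: r_def)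
    show "admissible id s" using rs sA by (intro adm)
    have r0: "parity_on {4, 5} (r i) = 0" for i by (simp add: r_def parity_on_def)
    show "[(\<Sum>i=1..t. parity_on {4, 5} (r i)) = (\<Sum>i=1..t. parity_on {4, 5} (s i))] (mod 2)"
      using supp[of "\<lambda>_. 1"] by (simp add: r0 cong_def)
    show "\<not> [(\<Sum>i=1..t. int i * parity_on {4, 5} (r i)) = (\<Sum>i=1..t. int i * parity_on {4, 5} (s i))] (mod 2)"
      using supp[of int] by (simp add: r0 cong_def)
    have p: "prev 4 = 3" "prev 3 = 2" "prev 2 = 1" by (simp_all add: prev_def)
    have "c 1 \<noteq> (b \<circ> b \<circ> c \<circ> b) 1" by (simp add: b_def c_def transpose_def)
    then have "c \<noteq> b \<circ> b \<circ> c \<circ> b" by metis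
    then show "r 4 \<otimes>\<^bsub>sym_group n\<^esub> s (prev 4) \<otimes>\<^bsub>sym_group n\<^esub> r (prev (prev 4)) \<otimes>\<^bsub>sym_group n\<^esub>
        s (prev (prev (prev 4))) \<noteq>
      s 4 \<otimes>\<^bsub>sym_group n\<^esub> r (prev 4) \<otimes>\<^bsub>sym_group n\<^esub> s (prev (prev 4)) \<otimes>\<^bsub>sym_group n\<^esub>
        r (prev (prev (prev 4)))"
      unfolding p by (simp add: r_def s_def sym_group_mult)
  qed (use t4 sH in \<open>auto simp: r_def\<close>)
  then show ?thesis unfolding sym_group_alt_carrier .
qed

section \<open>Rotations and odd divisors of \<open>t\<close>\<close>

definition rotation :: "nat \<Rightarrow> nat \<Rightarrow> nat \<Rightarrow> nat" where
  "rotation p k i = (if i \<in> {1..p} then (i - 1 + k) mod p + 1 else i)"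

lemma rotation_comp: "0 < p \<Longrightarrow> rotation p j \<circ> rotation p k = rotation p (j + k)"
  by (auto simp: rotation_def fun_eq_iff mod_simps add_ac Suc_le_eq)

lemma rotation_mod: "rotation p (k mod p) = rotation p k"
  by (intro ext) (simp only: rotation_def mod_add_right_eq)

lemma rotation_multiple:
  assumes "p dvd k" shows "rotation p k = id"
proof -
  have "rotation p k = rotation p 0" using rotation_mod[of p k] assms by simp
  also have "\<dots> = id" by (auto simp: rotation_def fun_eq_iff)
  finally show ?thesis .
qed

lemma dvd_pred_mult_add: "0 < p \<Longrightarrow> p dvd (p - 1) * k + k" for p k :: nat
  by (metis Suc_diff_1 add.commute dvd_triv_left mult_Suc)

text \<open>The rotation by \<open>(p - 1) * k\<close> serves as the inverse, avoiding negative
  exponents.\<close>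

lemma rotation_permutes:
  assumes "0 < p" "p \<le> n" shows "rotation p k permutes {1..n}"
proof -
  have "p dvd (p - 1) * k + k" "p dvd k + (p - 1) * k"
    using assms dvd_pred_mult_add[of p k] by (simp_all add: add.commute)
  then have "rotation p ((p - 1) * k) \<circ> rotation p k = id" "rotation p k \<circ> rotation p ((p - 1) * k) = id"
    using assms(1) by (simp_all add: rotation_comp rotation_multiple)
  then have "bij (rotation p k)" by (rule o_bij)
  then have "rotation p k permutes {1..p}"
    using assms(1) by (intro inj_imp_permutes) (auto simp: rotation_def bij_def Suc_le_eq intro: inj_on_subset)
  then show ?thesis by (rule permutes_subset) (use assms(2) in auto)
qed

text \<open>For odd \<open>p\<close> the number \<open>(p + 1) div 2\<close> inverts 2 modulo
  \<open>p\<close>, so every rotation is the square of a rotation.\<close>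

lemma evenperm_rotation:
  assumes "odd p" shows "evenperm (rotation p k)"
proof -
  have p: "0 < p" using assms by (cases p) auto
  define j where "j = k * ((p + 1) div 2)"
  have perm: "permutation (rotation p j)"
    using rotation_permutes[of p p j] p by (auto intro: permutes_imp_permutation)
  have "j + j = k * (2 * ((p + 1) div 2))" by (simp add: j_def)
  also have "2 * ((p + 1) div 2) = p + 1" using assms by simp
  finally have "(j + j) mod p = k mod p" by simp
  then have "rotation p k = rotation p j \<circ> rotation p j"
    using rotation_mod p by (metis rotation_comp)
  then show ?thesis using perm by (simp add: evenperm_comp)
qed

text \<open>The constant tuple \<open>id\<close> is compared with a rotation by 1 followed by its
  inverse. The angle, read off from the image of 1, is the character: its sum is \<open>p\<close>,
  but its weighted sum \<open>1 + 2 * (p - 1)\<close> is -1 modulo \<open>p\<close>.\<close>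

lemma alt_twisted_type_D_identity_odd:
  assumes p: "odd p" "1 < p" "p \<le> n" and pt: "p dvd t" "0 < t"
  shows "alt_twisted_type_D n t id id"
proof -
  have p3: "3 \<le> p" using p by (cases "p = 2") auto
  then have t3: "3 \<le> t" using pt by (auto dest: dvd_imp_le)
  interpret conj_twist "sym_group n" "carrier (alt_group n)" id "alt_conj n id" t
    using t3 by (intro conj_twist_alt_group) auto
  let ?H = "range (rotation p)"
  define r s :: "nat \<Rightarrow> nat \<Rightarrow> nat" where "r = (\<lambda>_. id)"
    and "s = (\<lambda>i. if i = 1 then rotation p 1 else if i = 2 then rotation p (p - 1) else id)"
  have p0: "0 < p" using p by simp
  have rot0: "id = rotation p 0" using rotation_multiple[of p 0] by simp
  have A: "rotation p k \<in> carrier (alt_group n)" for k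
    using rotation_permutes[OF p0 p(3)] evenperm_rotation[OF p(1)] by (simp add: alt_group_carrier)
  have C: "rotation p k \<in> carrier (sym_group n)" for k
    using rotation_permutes[OF p0 p(3)] by (simp add: sym_group_carrier)
  have H: "subgroup ?H (sym_group n)"
  proof (rule subgroupI)
    show "inv\<^bsub>sym_group n\<^esub> h \<in> ?H" if h: "h \<in> ?H" for h
    proof -
      obtain k where k: "h = rotation p k" using h by auto
      have "p dvd (p - 1) * k + k" using p0 by (rule dvd_pred_mult_add)
      then have "rotation p ((p - 1) * k) \<otimes>\<^bsub>sym_group n\<^esub> h = \<one>\<^bsub>sym_group n\<^esub>"
        using p0 by (simp add: k sym_group_mult sym_group_one rotation_comp rotation_multiple)
      then have "inv\<^bsub>sym_group n\<^esub> h = rotation p ((p - 1) * k)"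
        using C k by (intro inv_equality) auto
      then show ?thesis by simp
    qed
    show "g \<otimes>\<^bsub>sym_group n\<^esub> h \<in> ?H" if "g \<in> ?H" "h \<in> ?H" for g h
      using that p0 by (auto simp: sym_group_mult rotation_comp)
  qed (use C in auto)
  have sH: "s i \<in> ?H" "r i \<in> ?H" for i using rot0 by (auto simp: s_def r_def)
  have sA: "s i \<in> carrier (alt_group n)" "r i \<in> carrier (alt_group n)" for i
    using sH[of i] A by auto
  have rp: "rprod s (2 + k) = id" for k
  proof (induction k)
    case 0
    have "rotation p (p - 1) \<circ> rotation p 1 = id"
      using p0 by (simp add: rotation_comp rotation_multiple)
    then show ?case by (simp add: s_def numeral_eq_Suc sym_group_mult sym_group_one)
  next
    case (Suc k)
    moreover have "rprod s (2 + Suc k) = s (Suc (2 + k)) \<otimes>\<^bsub>sym_group n\<^esub> rprod s (2 + k)"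
      by (simp only: add_Suc_right rprod.simps)
    moreover have "s (Suc (2 + k)) = id" by (simp add: s_def)
    ultimately show ?case by (simp add: sym_group_mult)
  qed
  have "2 + (t - 2) = t" using t3 by simp
  with rp[of "t - 2"] have rs: "rprod s t = id" by metis
  have rr: "rprod r k = id" for k by (induction k) (simp_all add: r_def sym_group_mult sym_group_one)
  have idA: "id \<in> carrier (alt_group n)" by (simp add: alt_group_carrier)
  have idi: "inv\<^bsub>sym_group n\<^esub> id = id" using inv_one by (simp add: sym_group_one)
  have adm: "admissible id X" if "rprod X t = id" "\<And>i. X i \<in> carrier (alt_group n)" for X
    using that idA idi unfolding admissible_def
    by (auto simp: sym_group_mult sym_group_carrier alt_group_carrier intro!: bexI[of _ id])
  define \<chi> :: "(nat \<Rightarrow> nat) \<Rightarrow> int" where "\<chi> h = int (h 1) - 1" for h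
  have \<chi>: "\<chi> (rotation p k) = int (k mod p)" for k using p0 by (simp add: \<chi>_def rotation_def Suc_le_eq)
  have \<chi>s: "\<chi> (s i) = (if i = 1 then 1 else if i = 2 then int p - 1 else 0)" for i
    using p3 \<chi>[of 1] \<chi>[of "p - 1"] by (auto simp: s_def \<chi>_def[of id] of_nat_diff)
  have supp: "(\<Sum>i=1..t. f i * \<chi> (s i)) = f 1 + f 2 * (int p - 1)" for f :: "nat \<Rightarrow> int"
  proof -
    have "(\<Sum>i=1..t. f i * \<chi> (s i)) = (\<Sum>i\<in>{1, 2}. f i * \<chi> (s i))"
      using t3 by (intro sum.mono_neutral_right) (auto simp: \<chi>s)
    then show ?thesis by (simp add: \<chi>s)
  qed
  have r0: "\<chi> (r i) = 0" for i by (simp add: r_def \<chi>_def)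
  have neq: "rotation p 1 \<noteq> rotation p (p - 1)" "rotation p (p - 1) \<noteq> id"
  proof -
    have "\<chi> (rotation p 1) \<noteq> \<chi> (rotation p (p - 1))" "\<chi> (rotation p (p - 1)) \<noteq> \<chi> id"
      using p3 unfolding \<chi> by (simp_all add: \<chi>_def)
    then show "rotation p 1 \<noteq> rotation p (p - 1)" "rotation p (p - 1) \<noteq> id" by metis+
  qed
  have "type_D (twisted_op (sym_group n\<lparr>carrier := carrier (alt_group n)\<rparr>) t (alt_conj n id))
      (twisted_rack (sym_group n\<lparr>carrier := carrier (alt_group n)\<rparr>) t (alt_conj n id) id)"
  proof (rule type_D_character[OF idA H, where m = "int p" and \<chi> = \<chi> and r = r and s = s and i = 2])
    show "[\<chi> (g \<otimes>\<^bsub>sym_group n\<^esub> h) = \<chi> g + \<chi> h] (mod int p)" if gh: "g \<in> ?H" "h \<in> ?H" for g h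
    proof -
      obtain j k where jk: "g = rotation p j" "h = rotation p k" using gh by blast
      show ?thesis unfolding jk sym_group_mult rotation_comp[OF p0] \<chi>
        by (simp add: cong_def zmod_int mod_simps)
    qed
    show "admissible id r" using rr sA by (intro adm) auto
    show "admissible id s" using rs sA by (intro adm) auto
    show "[(\<Sum>i=1..t. \<chi> (r i)) = (\<Sum>i=1..t. \<chi> (s i))] (mod int p)"
      using supp[of "\<lambda>_. 1"] by (simp add: r0 cong_def)
    have "\<not> int p dvd 1 - 2 * int p"
    proof
      assume "int p dvd 1 - 2 * int p"
      then have "int p dvd 1 - 2 * int p + 2 * int p" by (intro dvd_add) auto
      then show False using p by simp
    qed
    then show "\<not> [(\<Sum>i=1..t. int i * \<chi> (r i)) = (\<Sum>i=1..t. int i * \<chi> (s i))] (mod int p)"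
      using supp[of int] by (simp add: r0 cong_iff_dvd_diff)
    have "prev 2 = 1" "prev 1 = t" "prev t = t - 1" using t3 by (simp_all add: prev_def)
    moreover have "s t = id" "s 1 \<circ> s (t - 1) \<noteq> s 2"
    proof -
      show "s t = id" using t3 by (simp add: s_def)
      \<comment> \<open>For \<open>t = 3\<close> the index \<open>t - 1\<close> is 2 again, and the
        left side is the identity; for larger \<open>t\<close> it is the rotation by 1. Neither is
        the inverse rotation, since \<open>p\<close> is at least 3.\<close>
      show "s 1 \<circ> s (t - 1) \<noteq> s 2"
      proof (cases "t = 3")
        case True
        then show ?thesis using neq p0 by (simp add: s_def rotation_comp rotation_multiple)
      next
        case False
        then have "t - 1 \<noteq> 1" "t - 1 \<noteq> 2" using t3 by linarith+
        then have "s (t - 1) = id" unfolding s_def by simp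
        moreover have "s 1 = rotation p 1" "s 2 = rotation p (p - 1)" by (simp_all add: s_def)
        ultimately show ?thesis using neq by simp
      qed
    qed
    ultimately show "r 2 \<otimes>\<^bsub>sym_group n\<^esub> s (prev 2) \<otimes>\<^bsub>sym_group n\<^esub> r (prev (prev 2)) \<otimes>\<^bsub>sym_group n\<^esub>
        s (prev (prev (prev 2))) \<noteq>
      s 2 \<otimes>\<^bsub>sym_group n\<^esub> r (prev 2) \<otimes>\<^bsub>sym_group n\<^esub> s (prev (prev 2)) \<otimes>\<^bsub>sym_group n\<^esub>
        r (prev (prev (prev 2)))"
      by (simp add: r_def sym_group_mult)
  qed (use pt t3 sH in \<open>auto\<close>)
  then show ?thesis unfolding sym_group_alt_carrier .
qed


section \<open>The classification\<close>

lemma cycle_type_eq_0_iff: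
  "cycle_type n p i = 0 \<longleftrightarrow> (\<forall>x\<in>{1..n}. card (orbit p x) \<noteq> i)"
proof -
  have "finite {C \<in> orbit p ` {1..n}. card C = i}" by simp
  then show ?thesis by (auto simp: cycle_type_def)
qed

lemma exists_two_fixed_points:
  assumes "permutation p" "2 \<le> cycle_type n p 1"
  obtains a b where "a \<in> {1..n}" "b \<in> {1..n}" "a \<noteq> b" "orbit p a = {a}" "orbit p b = {b}"
proof -
  have single: "orbit p a = {a}" if "card (orbit p a) = 1" for a
    using that permutation_self_in_orbit[OF assms(1), of a] by (auto simp: card_1_singleton_iff)
  obtain U where U: "U \<subseteq> {C \<in> orbit p ` {1..n}. card C = 1}" "card U = 2"
    using obtain_subset_with_card_n[OF assms(2)[unfolded cycle_type_def]] by metis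
  then obtain C D where CD: "C \<noteq> D" "U = {C, D}" by (auto simp: card_2_iff)
  then have "C \<in> orbit p ` {1..n}" "card C = 1" "D \<in> orbit p ` {1..n}" "card D = 1"
    using U by blast+
  moreover from this obtain a b where "a \<in> {1..n}" "C = orbit p a" "b \<in> {1..n}" "D = orbit p b"
    by blast
  ultimately show thesis using that[of a b] single CD by auto
qed

text \<open>For \<open>t = 2\<close> the commuting conjugate must have a different square, hence the
  condition on cycle lengths; for larger \<open>t\<close> any different commuting conjugate
  suffices.\<close>

lemma alt_twisted_type_D_nontrivial:
  assumes n: "5 \<le> n" and \<tau>: "\<tau> permutes {1..n}" and l: "l \<in> carrier (alt_group n)" and t: "2 \<le> t"
    and neq: "l \<circ> \<tau> \<noteq> id"
    and t2: "t = 2 \<Longrightarrow> \<exists>x\<in>{1..n}. card (orbit (l \<circ> \<tau>) x) \<notin> {1, 2, 4}"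
  shows "alt_twisted_type_D n t \<tau> l"
proof -
  have S: "finite {1..n}" "5 \<le> card {1..n}" using n by auto
  have p: "(l \<circ> \<tau>) permutes {1..n}" using l \<tau> by (auto simp: alt_group_carrier permutes_compose)
  show ?thesis
  proof (cases "t = 2")
    case True
    then obtain x where x: "x \<in> {1..n}" "card (orbit (l \<circ> \<tau>) x) \<notin> {1, 2, 4}" using t2 by blast
    obtain q where q: "alt_commuting_conj {1..n} (l \<circ> \<tau>) q" "q \<circ> q \<noteq> (l \<circ> \<tau>) \<circ> (l \<circ> \<tau>)"
      using alt_commuting_conj_square_neq[OF S p x] .
    then have "q \<noteq> l \<circ> \<tau>" by blast
    then show ?thesis using \<tau> t l q by (intro alt_twisted_type_D_commuting)
  next
    case False
    obtain q where "alt_commuting_conj {1..n} (l \<circ> \<tau>) q" "q \<noteq> l \<circ> \<tau>"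
      using alt_commuting_conj_neq[OF S p neq] .
    then show ?thesis using False \<tau> t l by (intro alt_twisted_type_D_commuting) auto
  qed
qed

text \<open>When \<open>t = 2\<close>, a cycle of even length is handled by signs. If all lengths
  are odd, any nontrivial cycle has a length outside \<open>{1, 2, 4}\<close>.\<close>

lemma alt_twisted_type_D_untwisted:
  assumes n: "5 \<le> n" and l: "l \<in> carrier (alt_group n)" "l \<noteq> id" and t: "2 \<le> t"
  shows "alt_twisted_type_D n t id l"
proof (cases "t = 2 \<and> (\<exists>x\<in>{1..n}. even (card (orbit l x)))")
  case True
  then show ?thesis using alt_twisted_type_D_even_orbit[OF n l(1)] by blast
next
  case False
  have lp: "l permutes {1..n}" using l by (simp add: alt_group_carrier)
  obtain x where "l x \<noteq> x" using l(2) by (auto simp: fun_eq_iff)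
  then have x: "x \<in> {1..n}" "card (orbit l x) \<noteq> 1"
    using permutes_not_in[OF lp] orbit_eq_singleton_iff[of l x]
      permutation_self_in_orbit[OF permutes_imp_permutation[OF _ lp], of x]
    by (auto simp: card_1_singleton_iff)
  have "\<exists>x\<in>{1..n}. card (orbit l x) \<notin> {1, 2, 4}" if "t = 2"
  proof (intro bexI)
    have "odd (card (orbit l x))" using False that x by blast
    then show "card (orbit l x) \<notin> {1, 2, 4}" using x by auto
  qed (rule x)
  then show ?thesis using l n t by (intro alt_twisted_type_D_nontrivial) auto
qed

text \<open>A common prime factor of \<open>t\<close> and \<open>fact n\<close> is at most
  \<open>n\<close>. An odd one permits rotations; the prime 2 makes \<open>t\<close> even, which is
  covered by the parity constructions.\<close>

lemma alt_twisted_type_D_identity: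
  assumes n: "5 \<le> n" and t: "2 \<le> t" "gcd t (fact n) \<noteq> 1" "t = 2 \<Longrightarrow> 7 \<le> n"
  shows "alt_twisted_type_D n t id id"
proof -
  obtain q where q: "prime q" "q dvd gcd t (fact n)" using prime_factor_nat[OF t(2)] by blast
  then have qn: "q \<le> n" and qt: "q dvd t" by (auto simp: prime_dvd_fact_iff)
  show ?thesis
  proof (cases "t = 2")
    case True
    then show ?thesis using t(3) alt_twisted_type_D_identity_2 by simp
  next
    case False
    show ?thesis
    proof (cases "q = 2")
      case True
      then have "even t" using qt by simp
      moreover from this have "4 \<le> t" using False t(1) by presburger
      ultimately show ?thesis using alt_twisted_type_D_identity_even n by blast
    next
      case False
      then have "odd q" "1 < q" using q(1) primes_dvd_imp_eq two_is_prime_nat prime_gt_1_nat by blast+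
      then show ?thesis using alt_twisted_type_D_identity_odd qn qt t(1) by simp
    qed
  qed
qed

text \<open>An odd permutation is not the identity, so in the absence of 2-cycles it has a 4-cycle.
  The two fixed points serve as the transposition outside it.\<close>

lemma alt_twisted_type_D_odd:
  assumes n: "5 \<le> n" and \<tau>: "\<tau> permutes {1..n}" "\<not> evenperm \<tau>" and l: "l \<in> carrier (alt_group n)"
    and ct: "2 \<le> cycle_type n (l \<circ> \<tau>) 1" "cycle_type n (l \<circ> \<tau>) 2 = 0"
      "\<And>i. i \<notin> {1, 2, 4} \<Longrightarrow> cycle_type n (l \<circ> \<tau>) i = 0"
  shows "alt_twisted_type_D n 2 \<tau> l"
proof -
  let ?\<sigma> = "l \<circ> \<tau>"
  have lp: "l permutes {1..n}" "evenperm l" "permutation l"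
    using l by (auto simp: alt_group_carrier intro: permutes_imp_permutation)
  have \<sigma>p: "?\<sigma> permutes {1..n}" using lp \<tau> by (simp add: permutes_compose)
  have ps: "permutation ?\<sigma>" "permutation \<tau>" using \<sigma>p \<tau> by (auto intro: permutes_imp_permutation)
  have "\<not> evenperm ?\<sigma>" using lp \<tau> ps by (simp add: evenperm_comp)
  then have "?\<sigma> \<noteq> id" by (metis evenperm_id)
  then obtain x where x: "?\<sigma> x \<noteq> x" by (auto simp: fun_eq_iff)
  then have xn: "x \<in> {1..n}" using permutes_not_in[OF \<sigma>p] by blast
  have "card (orbit ?\<sigma> x) \<noteq> 1"
    using x orbit_eq_singleton_iff[of ?\<sigma> x] permutation_self_in_orbit[OF ps(1), of x]
    by (auto simp: card_1_singleton_iff)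
  moreover have "card (orbit ?\<sigma> x) \<in> {1, 2, 4}" "card (orbit ?\<sigma> x) \<noteq> 2"
    using ct(2,3) xn unfolding cycle_type_eq_0_iff by blast+
  ultimately have x4: "card (orbit ?\<sigma> x) = 4" by blast
  obtain a b where ab: "a \<in> {1..n}" "b \<in> {1..n}" "a \<noteq> b" "orbit ?\<sigma> a = {a}" "orbit ?\<sigma> b = {b}"
    using exists_two_fixed_points[OF ps(1) ct(1)] .
  have "y \<notin> orbit ?\<sigma> x" if "orbit ?\<sigma> y = {y}" for y
  proof
    assume "y \<in> orbit ?\<sigma> x"
    then have "{y} = orbit ?\<sigma> x"
      using orbit_cyclic_eq3[OF cyclic_on_orbit'[OF ps(1)]] that by metis
    then have "card {y} = 4" using x4 by metis
    then show False by simp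
  qed
  then show ?thesis
    using ab by (intro alt_twisted_type_D_four_orbit[OF \<tau> l xn x4, of a b]) auto
qed

theorem theorem1p1:
  fixes n t :: nat and l :: "nat \<Rightarrow> nat" and \<theta> :: "(nat \<Rightarrow> nat) \<Rightarrow> (nat \<Rightarrow> nat)"
  assumes "n \<ge> 5"
    and "l \<in> carrier (alt_group n)"
    and "t > 1"
    and "\<theta> \<in> {(\<lambda>g\<in>carrier (alt_group n). g), alt_conj n (Transposition.transpose 1 2)}"
    and "\<not> type_D (twisted_op (alt_group n) t \<theta>) (twisted_rack (alt_group n) t \<theta> l)"
  shows
    "(\<theta> = (\<lambda>g\<in>carrier (alt_group n). g) \<and> l = \<one>\<^bsub>alt_group n\<^esub> \<and> gcd t (fact n) = 1) \<or>
     (\<theta> = (\<lambda>g\<in>carrier (alt_group n). g) \<and> l = \<one>\<^bsub>alt_group n\<^esub> \<and> n = 5 \<and> t = 2) \<or>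
     (\<theta> = (\<lambda>g\<in>carrier (alt_group n). g) \<and> l = \<one>\<^bsub>alt_group n\<^esub> \<and> n = 6 \<and> t = 2) \<or>
     (\<theta> = alt_conj n (Transposition.transpose 1 2) \<and>
        cycle_type n (l \<circ> Transposition.transpose 1 2) 1 \<le> 1 \<and>
        cycle_type n (l \<circ> Transposition.transpose 1 2) 2 = 0) \<or>
     (\<theta> = alt_conj n (Transposition.transpose 1 2) \<and>
        (\<forall>i. i \<notin> {1, 2, 4} \<longrightarrow> cycle_type n (l \<circ> Transposition.transpose 1 2) i = 0) \<and>
        (cycle_type n (l \<circ> Transposition.transpose 1 2) 1 \<le> 2 \<or>
         cycle_type n (l \<circ> Transposition.transpose 1 2) 2 \<ge> 1) \<and> t = 2)"
proof (cases "\<theta> = (\<lambda>g\<in>carrier (alt_group n). g)")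
  case True
  have t: "2 \<le> t" using assms(3) by simp
  have not_D: "\<not> alt_twisted_type_D n t id l" using assms(5) True by (simp add: alt_conj_id)
  then have l: "l = id" using alt_twisted_type_D_untwisted assms(1,2) t by blast
  then have "gcd t (fact n) = 1 \<or> t = 2 \<and> n < 7"
    using not_D alt_twisted_type_D_identity[OF assms(1) t] by (metis not_less)
  moreover have "n = 5 \<or> n = 6" if "n < 7" using that assms(1) by linarith
  ultimately show ?thesis using True l unfolding alt_group_one by blast
next
  case False
  let ?\<tau> = "Transposition.transpose 1 2 :: nat \<Rightarrow> nat"
  have \<theta>: "\<theta> = alt_conj n ?\<tau>" using False assms(4) by blast
  have t: "2 \<le> t" using assms(3) by simp
  have not_D: "\<not> alt_twisted_type_D n t ?\<tau> l" using assms(5) \<theta> by simp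
  have \<tau>: "?\<tau> permutes {1..n}" "\<not> evenperm ?\<tau>"
    using assms(1) by (auto simp: permutes_swap_id evenperm_swap)
  have "evenperm l" "permutation l"
    using assms(2) alt_group_carrier'[OF assms(2)] by (simp_all add: alt_group_carrier)
  then have "\<not> evenperm (l \<circ> ?\<tau>)" using \<tau> by (simp add: evenperm_comp permutation_swap_id)
  then have "l \<circ> ?\<tau> \<noteq> id" by (metis evenperm_id)
  \<comment> \<open>Oddness rules out the identity, so commuting conjugates leave only
    \<open>t = 2\<close> with all cycle lengths in \<open>{1, 2, 4}\<close>.\<close>
  then have small: "t = 2" "\<forall>x\<in>{1..n}. card (orbit (l \<circ> ?\<tau>) x) \<in> {1, 2, 4}"
    using not_D alt_twisted_type_D_nontrivial[OF assms(1) \<tau>(1) assms(2) t] by blast+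
  then have ct: "cycle_type n (l \<circ> ?\<tau>) i = 0" if "i \<notin> {1, 2, 4}" for i
    using that unfolding cycle_type_eq_0_iff by blast
  \<comment> \<open>A failure would mean at least three fixed points and no 2-cycle, hence a 4-cycle
    with two points to spare outside it.\<close>
  have "cycle_type n (l \<circ> ?\<tau>) 1 \<le> 2 \<or> cycle_type n (l \<circ> ?\<tau>) 2 \<ge> 1"
  proof (rule ccontr)
    assume "\<not> ?thesis"
    then have "2 \<le> cycle_type n (l \<circ> ?\<tau>) 1" "cycle_type n (l \<circ> ?\<tau>) 2 = 0" by linarith+
    then show False
      using alt_twisted_type_D_odd[OF assms(1) \<tau> assms(2)] ct not_D small(1) by blast
  qed
  then show ?thesis using \<theta> ct small(1) by blast
qed

end
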